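(* For the leapfrog map, there is a scaling symmetry acting, in the coordinates $(o_i^-,o_i)_{i\in\mathbb{Z}}$, as $$o_i^-(t)=t\,o_i^-,\qquad o_i(t)=o_i.$$ It is well defined for any $t\in\mathbb{G}_m$.
   Context: Let $F$ be a field, $\mathbb{P}^1=\mathbb{P}^1(F)$, $\mathrm{PGL}_2=\mathrm{GL}_2(F)/F^*$, $\mathbb{G}_m=F^*$ (as algebraic group). For four points of $\mathbb{P}^1$, $[a,b,c,d]=\frac{a-c}{a-d}\cdot\frac{b-d}{b-c}$. A (twisted) $m$-gon in $\mathbb{P}^1$ is $((p_i)_{i\in\mathbb{Z}},M)$ with monodromy $M\in\mathrm{PGL}_2$, $p_{i+m}=Mp_i$, with $p_i,p_{i+1},p_{i+2}$ pairwise distinct for all $i$; $\mathrm{PGL}_2$ acts by $A\cdot((p_i),M)=((Ap_i),AMA^{-1})$, with quotient the moduli space $\mathcal T_m$. Leapfrog map: take two $n$-gons $S^-=(s_i^-)_{i\in\mathbb{Z}}$, $S=(s_i)_{i\in\mathbb{Z}}$ with the same monodromy, intertwined as $\dots,s_i^-,s_i,s_{i+1}^-,s_{i+1},\dots$ to form a $2n$-gon $P$. The map is $\Phi:(S^-,S)\mapsto(S,S^+)$, where $s_i^+$ is the image of $s_i^-$ under the unique projective transformation that fixes $s_i$ and interchanges $s_{i-1}$ with $s_{i+1}$. The coordinates on the moduli space are $o_i^-=[s_i^-,s_i,s_{i-1},s_{i+1}^-]$ and $o_i=[s_i,s_{i+1}^-,s_i^-,s_{i+1}]$ ($n$-periodic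 in $i$; they are the consecutive cross-ratio coordinates of the $2n$-gon $P$ and determine its class). A scaling symmetry is a non-trivial action of the algebraic group $\mathbb{G}_m$ on the moduli space $\mathcal T_{2n}$, $(t,[P])\mapsto[P]_t$, which commutes with the dynamic (here the map induced by $\Phi$ on the moduli space); $o_i^-(t),o_i(t)$ are the coordinates of $[P]_t$. *)

theory Defs
  imports "HOL-Analysis.Determinants" "HOL-Library.Poly_Mapping"
begin

subsection \<open>The projective line and its automorphism group\<close>

definition proj_rel :: "'a::field ^ 2 \<Rightarrow> 'a ^ 2 \<Rightarrow> bool" where
  "proj_rel v w \<longleftrightarrow> v \<noteq> 0 \<and> w \<noteq> 0 \<and> (\<exists>c. c \<noteq> 0 \<and> w = c *s v)"

lemma proj_rel_part_equivp: "part_equivp (proj_rel :: 'a::field ^ 2 \<Rightarrow> _)"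
proof (rule part_equivpI)
  have "proj_rel (axis 1 1) (axis 1 (1::'a) :: 'a ^ 2)"
    unfolding proj_rel_def by (auto simp: axis_eq_0_iff intro!: exI[of _ 1])
  then show "\<exists>x. proj_rel x (x :: 'a ^ 2)" by blast
  show "symp (proj_rel :: 'a ^ 2 \<Rightarrow> _)"
  proof (rule sympI)
    fix v w :: "'a ^ 2" assume "proj_rel v w"
    then obtain c where c: "v \<noteq> 0" "w \<noteq> 0" "c \<noteq> 0" "w = c *s v"
      unfolding proj_rel_def by blast
    then have "v = inverse c *s w" by (simp add: vector_smult_assoc)
    with c show "proj_rel w v" unfolding proj_rel_def
      using nonzero_imp_inverse_nonzero by blast
  qed
  show "transp (proj_rel :: 'a ^ 2 \<Rightarrow> _)"
  proof (rule transpI)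
    fix u v w :: "'a ^ 2" assume "proj_rel u v" "proj_rel v w"
    then obtain c d where "u \<noteq> 0" "w \<noteq> 0" "c \<noteq> 0" "d \<noteq> 0" "v = c *s u" "w = d *s v"
      unfolding proj_rel_def by blast
    then show "proj_rel u w" unfolding proj_rel_def
      by (auto simp: vector_smult_assoc intro!: exI[of _ "d * c"])
  qed
qed

quotient_type (overloaded) 'a proj_line = "'a::field ^ 2" / partial: proj_rel
  by (rule proj_rel_part_equivp)

definition pgl_rel :: "'a::field ^ 2 ^ 2 \<Rightarrow> 'a ^ 2 ^ 2 \<Rightarrow> bool" where
  "pgl_rel A B \<longleftrightarrow> invertible A \<and> invertible B \<and> (\<exists>c. c \<noteq> 0 \<and> B = (\<chi> i. c *s A $ i))"

lemma pgl_rel_part_equivp: "part_equivp (pgl_rel :: 'a::field ^ 2 ^ 2 \<Rightarrow> _)"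
proof (rule part_equivpI)
  have "pgl_rel (mat 1) (mat 1 :: 'a ^ 2 ^ 2)"
    unfolding pgl_rel_def
    by (auto simp: invertible_det_nz vec_eq_iff intro!: exI[of _ 1])
  then show "\<exists>x. pgl_rel x (x :: 'a ^ 2 ^ 2)" by blast
  show "symp (pgl_rel :: 'a ^ 2 ^ 2 \<Rightarrow> _)"
  proof (rule sympI)
    fix A B :: "'a ^ 2 ^ 2" assume "pgl_rel A B"
    then obtain c where c: "invertible A" "invertible B" "c \<noteq> 0" "B = (\<chi> i. c *s A $ i)"
      unfolding pgl_rel_def by blast
    then have "A = (\<chi> i. inverse c *s B $ i)" by (simp add: vec_eq_iff)
    with c show "pgl_rel B A" unfolding pgl_rel_def
      using nonzero_imp_inverse_nonzero by blast
  qed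
  show "transp (pgl_rel :: 'a ^ 2 ^ 2 \<Rightarrow> _)"
  proof (rule transpI)
    fix A B C :: "'a ^ 2 ^ 2" assume "pgl_rel A B" "pgl_rel B C"
    then obtain c d where "invertible A" "invertible C" "c \<noteq> 0" "d \<noteq> 0"
      "B = (\<chi> i. c *s A $ i)" "C = (\<chi> i. d *s B $ i)"
      unfolding pgl_rel_def by blast
    moreover from this have "C = (\<chi> i. (d * c) *s A $ i)"
      by (simp add: vec_eq_iff ac_simps)
    moreover have "d * c \<noteq> 0" using \<open>c \<noteq> 0\<close> \<open>d \<noteq> 0\<close> by simp
    ultimately show "pgl_rel A C" unfolding pgl_rel_def by blast
  qed
qed

quotient_type (overloaded) 'a pgl2 = "'a::field ^ 2 ^ 2" / partial: pgl_rel
  by (rule pgl_rel_part_equivp)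

lemma scale_matrix_vector: "(\<chi> i. c *s A $ i) *v (d *s v) = (c * d) *s (A *v v)"
  for A :: "'a::field ^ 2 ^ 2"
  by (simp add: matrix_vector_mult_def vec_eq_iff sum_distrib_left ac_simps)

lemma scale_matrix_matrix:
  "(\<chi> i. c *s A $ i) ** (\<chi> i. d *s B $ i) = (\<chi> i. (c * d) *s (A ** B) $ i)"
  for A :: "'a::field ^ 2 ^ 2"
  by (simp add: matrix_matrix_mult_def vec_eq_iff sum_distrib_left ac_simps)

lemma invertible_mult_vec_nonzero: "invertible A \<Longrightarrow> v \<noteq> 0 \<Longrightarrow> A *v v \<noteq> 0"
  for A :: "'a::field ^ 2 ^ 2"
  by (metis invertible_def matrix_vector_mul_assoc matrix_vector_mul_lid matrix_vector_mult_0_right)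

lift_definition pgl_act :: "'a::field pgl2 \<Rightarrow> 'a proj_line \<Rightarrow> 'a proj_line" is "(*v)"
proof -
  fix A B :: "'a ^ 2 ^ 2" and v w :: "'a ^ 2"
  assume "pgl_rel A B" "proj_rel v w"
  then obtain c d where "invertible A" "invertible B" "v \<noteq> 0" "w \<noteq> 0" "c \<noteq> 0" "d \<noteq> 0"
    and eq: "B = (\<chi> i. c *s A $ i)" "w = d *s v"
    unfolding pgl_rel_def proj_rel_def by blast
  moreover from this have "c * d \<noteq> 0" by simp
  moreover have "B *v w = (c * d) *s (A *v v)" unfolding eq by (rule scale_matrix_vector)
  ultimately show "proj_rel (A *v v) (B *v w)"
    unfolding proj_rel_def using invertible_mult_vec_nonzero by blast
qed

lift_definition pgl_mult :: "'a::field pgl2 \<Rightarrow> 'a pgl2 \<Rightarrow> 'a pgl2" is "(**)"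
proof -
  fix A B C D :: "'a ^ 2 ^ 2"
  assume "pgl_rel A B" "pgl_rel C D"
  then obtain c d where "invertible A" "invertible B" "invertible C" "invertible D"
    "c \<noteq> 0" "d \<noteq> 0" and eq: "B = (\<chi> i. c *s A $ i)" "D = (\<chi> i. d *s C $ i)"
    unfolding pgl_rel_def by blast
  moreover from this have "c * d \<noteq> 0" by simp
  moreover have "B ** D = (\<chi> i. (c * d) *s (A ** C) $ i)"
    unfolding eq by (rule scale_matrix_matrix)
  ultimately show "pgl_rel (A ** C) (B ** D)"
    unfolding pgl_rel_def using invertible_mult by blast
qed

lemma matrix_inv_props:
  assumes "invertible (A :: 'a::field ^ 2 ^ 2)"
  shows "A ** matrix_inv A = mat 1" "matrix_inv A ** A = mat 1"
  using assms someI_ex[of "\<lambda>A'. A ** A' = mat 1 \<and> A' ** A = mat 1"]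
  unfolding invertible_def matrix_inv_def by auto

lift_definition pgl_inv :: "'a::field pgl2 \<Rightarrow> 'a pgl2" is matrix_inv
proof -
  fix A B :: "'a ^ 2 ^ 2"
  assume "pgl_rel A B"
  then obtain c where A: "invertible A" and B: "invertible B" and c: "c \<noteq> 0"
    and eq: "B = (\<chi> i. c *s A $ i)"
    unfolding pgl_rel_def by blast
  let ?C = "\<chi> i. inverse c *s matrix_inv A $ i"
  have "B ** ?C = mat 1"
    unfolding eq scale_matrix_matrix using c matrix_inv_props[OF A] by (simp add: vec_eq_iff)
  have "matrix_inv B = matrix_inv B ** (B ** ?C)"
    unfolding \<open>B ** ?C = mat 1\<close> by simp
  also have "\<dots> = ?C"
    unfolding matrix_mul_assoc matrix_inv_props(2)[OF B] by simp
  finally have "matrix_inv B = ?C" .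
  moreover have "invertible (matrix_inv A)" "invertible (matrix_inv B)"
    using matrix_inv_props A B unfolding invertible_def by blast+
  ultimately show "pgl_rel (matrix_inv A) (matrix_inv B)"
    unfolding pgl_rel_def using c nonzero_imp_inverse_nonzero by blast
qed

text \<open>In homogeneous coordinates the difference \<open>a - c\<close> of two affine points
  \<open>[a : 1]\<close>, \<open>[c : 1]\<close> becomes the determinant \<open>bracket a c\<close>; the quotient below is
  \<open>(a - c) / (a - d) * (b - d) / (b - c)\<close> and makes sense also at infinity.\<close>

definition bracket :: "'a::field ^ 2 \<Rightarrow> 'a ^ 2 \<Rightarrow> 'a" where
  "bracket v w = v $ 1 * w $ 2 - v $ 2 * w $ 1"

lift_definition cross_ratio ::
  "'a::field proj_line \<Rightarrow> 'a proj_line \<Rightarrow> 'a proj_line \<Rightarrow> 'a proj_line \<Rightarrow> 'a"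
  is "\<lambda>a b c d. bracket a c / bracket a d * (bracket b d / bracket b c)"
proof -
  have scale: "bracket (r *s v) (s *s w) = (r * s) * bracket v w" for r s :: 'a and v w
    by (simp add: bracket_def algebra_simps)
  show "\<And>a a' b b' c c' d d' :: 'a ^ 2.
    \<lbrakk>proj_rel a a'; proj_rel b b'; proj_rel c c'; proj_rel d d'\<rbrakk> \<Longrightarrow>
      bracket a c / bracket a d * (bracket b d / bracket b c) =
      bracket a' c' / bracket a' d' * (bracket b' d' / bracket b' c')"
    unfolding proj_rel_def by (auto simp: scale)
qed


subsection \<open>Twisted polygons and their moduli space\<close>

type_synonym 'a twisted = "(int \<Rightarrow> 'a proj_line) \<times> 'a pgl2"

definition polygons :: "nat \<Rightarrow> 'a::field twisted set" where
  "polygons m = {(p, M).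
     (\<forall>i. p (i + int m) = pgl_act M (p i)) \<and>
     (\<forall>i. p i \<noteq> p (i + 1) \<and> p (i + 1) \<noteq> p (i + 2) \<and> p i \<noteq> p (i + 2))}"

definition pgl_act_polygon :: "'a::field pgl2 \<Rightarrow> 'a twisted \<Rightarrow> 'a twisted" where
  "pgl_act_polygon A P =
     ((\<lambda>i. pgl_act A (fst P i)), pgl_mult (pgl_mult A (snd P)) (pgl_inv A))"

definition polygon_equiv :: "nat \<Rightarrow> ('a::field twisted \<times> 'a twisted) set" where
  "polygon_equiv m = {(P, Q). P \<in> polygons m \<and> Q \<in> polygons m \<and> (\<exists>A. Q = pgl_act_polygon A P)}"

definition moduli :: "nat \<Rightarrow> 'a::field twisted set set" where
  "moduli m = polygons m // polygon_equiv m"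

definition polygon_class :: "nat \<Rightarrow> 'a::field twisted \<Rightarrow> 'a twisted set" where
  "polygon_class m P = polygon_equiv m `` {P}"

text \<open>Cross-ratios are constant on \<open>PGL\<^sub>2\<close>-orbits, so the image of a class below is a singleton.
  Coordinate \<open>k\<close> of an \<open>m\<close>-gon depends on \<open>k\<close> modulo \<open>m\<close> only.\<close>

definition coordinate :: "'a::field twisted set \<Rightarrow> int \<Rightarrow> 'a" where
  "coordinate C k =
     the_elem ((\<lambda>(p, M). cross_ratio (p k) (p (k + 1)) (p (k - 1)) (p (k + 2))) ` C)"


subsection \<open>The leapfrog map\<close>

definition intertwine ::
  "(int \<Rightarrow> 'a proj_line) \<Rightarrow> (int \<Rightarrow> 'a proj_line) \<Rightarrow> int \<Rightarrow> 'a::field proj_line" where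
  "intertwine Sm S k = (if even k then Sm (k div 2) else S (k div 2))"

definition leapfrog_pairs ::
  "nat \<Rightarrow> ((int \<Rightarrow> 'a::field proj_line) \<times> (int \<Rightarrow> 'a proj_line) \<times> 'a pgl2) set" where
  "leapfrog_pairs n = {(Sm, S, M). (Sm, M) \<in> polygons n \<and> (S, M) \<in> polygons n \<and>
     (intertwine Sm S, M) \<in> polygons (2 * n)}"

definition leapfrog_plus ::
  "(int \<Rightarrow> 'a::field proj_line) \<Rightarrow> (int \<Rightarrow> 'a proj_line) \<Rightarrow> int \<Rightarrow> 'a proj_line" where
  "leapfrog_plus Sm S i =
     pgl_act (THE A. pgl_act A (S i) = S i \<and> pgl_act A (S (i - 1)) = S (i + 1) \<and>
                     pgl_act A (S (i + 1)) = S (i - 1)) (Sm i)"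

text \<open>The leapfrog map is only partially defined, since \<open>(S, S\<^sup>+)\<close> may fail to intertwine to a
  \<open>2n\<close>-gon. The map it induces on the moduli space is given by its graph.\<close>

definition leapfrog :: "nat \<Rightarrow> 'a::field twisted set \<Rightarrow> 'a twisted set \<Rightarrow> bool" where
  "leapfrog n C D \<longleftrightarrow> (\<exists>Sm S M. (Sm, S, M) \<in> leapfrog_pairs n \<and>
     (intertwine S (leapfrog_plus Sm S), M) \<in> polygons (2 * n) \<and>
     C = polygon_class (2 * n) (intertwine Sm S, M) \<and>
     D = polygon_class (2 * n) (intertwine S (leapfrog_plus Sm S), M))"

text \<open>For the class of the intertwined polygon \<open>p\<close> one has \<open>s\<^sub>i\<^sup>- = p (2 * i)\<close> and
  \<open>s\<^sub>i = p (2 * i + 1)\<close>.\<close>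

definition o_minus :: "'a::field twisted set \<Rightarrow> int \<Rightarrow> 'a" where
  "o_minus C i = the_elem ((\<lambda>(p, M).
     let sm = (\<lambda>j. p (2 * j)); s = (\<lambda>j. p (2 * j + 1))
     in cross_ratio (sm i) (s i) (s (i - 1)) (sm (i + 1))) ` C)"

definition o_plain :: "'a::field twisted set \<Rightarrow> int \<Rightarrow> 'a" where
  "o_plain C i = the_elem ((\<lambda>(p, M).
     let sm = (\<lambda>j. p (2 * j)); s = (\<lambda>j. p (2 * j + 1))
     in cross_ratio (s i) (sm (i + 1)) (sm i) (s (i + 1))) ` C)"


subsection \<open>Actions of the multiplicative group\<close>

text \<open>For \<open>m \<ge> 1\<close> the coordinates \<open>0, \<dots>, m - 1\<close> identify the moduli space of \<open>m\<close>-gons with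
  the torus of \<open>m\<close>-tuples of nonzero scalars: \<open>p\<^sub>k\<^sub>+\<^sub>2\<close> may be any point other than
  \<open>p\<^sub>k\<close>, \<open>p\<^sub>k\<^sub>+\<^sub>1\<close>, which means that coordinate \<open>k\<close> is any element of \<open>F - {0}\<close>. Its ring of regular
  functions is therefore the ring of Laurent polynomials in these coordinates, where the
  exponent of a monomial is a finitely supported map from variables to integers.\<close>

type_synonym 'a laurent = "(nat \<Rightarrow>\<^sub>0 int) \<Rightarrow>\<^sub>0 'a"

definition regular_functions :: "nat \<Rightarrow> 'a::field laurent set" where
  "regular_functions m = {f. \<forall>e \<in> Poly_Mapping.keys f. Poly_Mapping.keys e \<subseteq> {..<m}}"

definition coordinate_function :: "nat \<Rightarrow> 'a::field laurent" where
  "coordinate_function k = Poly_Mapping.single (Poly_Mapping.single k 1) 1"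

definition regular_value :: "'a::field laurent \<Rightarrow> 'a twisted set \<Rightarrow> 'a" where
  "regular_value f C =
     (\<Sum>e\<in>Poly_Mapping.keys f. Poly_Mapping.lookup f e * (\<Prod>k\<in>Poly_Mapping.keys e. coordinate C (int k) powi Poly_Mapping.lookup e k))"

text \<open>An action of the algebraic group \<open>\<bbbG>\<^sub>m\<close> on an affine variety with coordinate ring \<open>R\<close> is a
  homomorphism \<open>\<rho>\<close> of \<open>F\<close>-algebras from \<open>R\<close> to \<open>R[t, t\<^sup>-\<^sup>1]\<close> which is counital (\<open>t = 1\<close> acts as
  the identity) and coassociative (acting by \<open>s\<close> and \<open>t\<close> is acting by \<open>s t\<close>: comparing
  coefficients of \<open>t\<^sup>k s\<^sup>l\<close> gives the last clause). Points over \<open>F\<close> do not suffice here because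
  \<open>F\<close> may be finite.\<close>

definition Gm_coaction :: "nat \<Rightarrow> ('a::field laurent \<Rightarrow> (int \<Rightarrow>\<^sub>0 'a laurent)) \<Rightarrow> bool" where
  "Gm_coaction m \<rho> \<longleftrightarrow>
     (\<forall>f \<in> regular_functions m. \<forall>k. Poly_Mapping.lookup (\<rho> f) k \<in> regular_functions m) \<and>
     (\<forall>c. \<rho> (Poly_Mapping.single 0 c) = Poly_Mapping.single 0 (Poly_Mapping.single 0 c)) \<and>
     (\<forall>f \<in> regular_functions m. \<forall>g \<in> regular_functions m.
        \<rho> (f + g) = \<rho> f + \<rho> g \<and> \<rho> (f * g) = \<rho> f * \<rho> g) \<and>
     (\<forall>f \<in> regular_functions m. (\<Sum>k\<in>Poly_Mapping.keys (\<rho> f). Poly_Mapping.lookup (\<rho> f) k) = f) \<and>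
     (\<forall>f \<in> regular_functions m. \<forall>k l.
        Poly_Mapping.lookup (\<rho> (Poly_Mapping.lookup (\<rho> f) k)) l = (if k = l then Poly_Mapping.lookup (\<rho> f) k else 0))"

text \<open>\<open>act\<close> is the effect on points over \<open>F\<close> of the algebraic action with coaction \<open>\<rho>\<close>.\<close>

definition algebraic_Gm_action ::
  "nat \<Rightarrow> ('a::field \<Rightarrow> 'a twisted set \<Rightarrow> 'a twisted set) \<Rightarrow>
     ('a laurent \<Rightarrow> (int \<Rightarrow>\<^sub>0 'a laurent)) \<Rightarrow> bool" where
  "algebraic_Gm_action m act \<rho> \<longleftrightarrow>
     (\<forall>t C. t \<noteq> 0 \<longrightarrow> C \<in> moduli m \<longrightarrow> act t C \<in> moduli m) \<and>
     (\<forall>C \<in> moduli m. act 1 C = C) \<and>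
     (\<forall>t s C. t \<noteq> 0 \<longrightarrow> s \<noteq> 0 \<longrightarrow> C \<in> moduli m \<longrightarrow> act (t * s) C = act t (act s C)) \<and>
     Gm_coaction m \<rho> \<and>
     (\<forall>t C f. t \<noteq> 0 \<longrightarrow> C \<in> moduli m \<longrightarrow> f \<in> regular_functions m \<longrightarrow>
        regular_value f (act t C) =
        (\<Sum>k\<in>Poly_Mapping.keys (\<rho> f). t powi k * regular_value (Poly_Mapping.lookup (\<rho> f) k) C))"

text \<open>As usual for partially defined maps, commuting is required wherever both composites are
  defined.\<close>

definition scaling_symmetry ::
  "nat \<Rightarrow> ('a::field \<Rightarrow> 'a twisted set \<Rightarrow> 'a twisted set) \<Rightarrow>
     ('a laurent \<Rightarrow> (int \<Rightarrow>\<^sub>0 'a laurent)) \<Rightarrow> bool" where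
  "scaling_symmetry n act \<rho> \<longleftrightarrow>
     algebraic_Gm_action (2 * n) act \<rho> \<and>
     (\<exists>f \<in> regular_functions (2 * n). \<rho> f \<noteq> Poly_Mapping.single 0 f) \<and>
     (\<forall>t C D E. t \<noteq> 0 \<longrightarrow> leapfrog n C D \<longrightarrow> leapfrog n (act t C) E \<longrightarrow> E = act t D)"

end

theory Submission
  imports Defs
begin

text \<open>Lift the vertices of a twisted polygon \<open>p\<close> to vectors. Since any three consecutive vertices are
  distinct, the lift \<open>v\<close> can be normalised so that \<open>v\<^sub>k\<^sub>+\<^sub>2 = v\<^sub>k\<^sub>+\<^sub>1 - c\<^sub>k v\<^sub>k\<close>, and then the coefficient
  \<open>c\<^sub>k\<close> is exactly the consecutive cross-ratio \<open>[p\<^sub>k, p\<^sub>k\<^sub>+\<^sub>1, p\<^sub>k\<^sub>-\<^sub>1, p\<^sub>k\<^sub>+\<^sub>2]\<close> (\<open>lift_exists\<close>,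
  \<open>consecutive_cross_ratio_recurrent\<close>). Two \<open>m\<close>-gons are equivalent iff their cross-ratios agree
  (\<open>polygon_equiv_iff\<close>), and every \<open>m\<close>-periodic sequence of nonzero scalars is realised by solving the
  recurrence; the monodromy is the matrix that translates solutions by \<open>m\<close>
  (\<open>polygon_with_cross_ratios\<close>). So the moduli space is a torus, and multiplying the even
  coordinates by \<open>t\<close> is an action defined for every nonzero \<open>t\<close>.

  The lift makes the leapfrog map explicit. Write \<open>x\<^sub>i = o\<^sub>i\<^sup>-\<close> and \<open>y\<^sub>i = o\<^sub>i\<close>. The involution that fixes
  \<open>s\<^sub>i\<close> and swaps its neighbours is a \<open>2\<times>2\<close> matrix in the basis of the lifts of \<open>s\<^sub>i\<^sup>-, s\<^sub>i\<close>, which gives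
  a lift of \<open>s\<^sub>i\<^sup>+\<close> (\<open>leapfrog_plus_lift\<close>). With \<open>\<Delta>\<^sub>i = x\<^sub>i\<^sub>+\<^sub>1 y\<^sub>i + x\<^sub>i - x\<^sub>i y\<^sub>i\<^sub>+\<^sub>1\<close> the new coordinates are
  \<open>o\<^sub>i = x\<^sub>i\<^sub>+\<^sub>1 y\<^sub>i / \<Delta>\<^sub>i\<close> and \<open>o\<^sub>i\<^sub>+\<^sub>1\<^sup>- = x\<^sub>i x\<^sub>i\<^sub>+\<^sub>1 / \<Delta>\<^sub>i\<close> (\<open>leapfrog_o_plain\<close>, \<open>leapfrog_o_minus\<close>). As
  \<open>\<Delta>\<close> is homogeneous of degree 1 in \<open>x\<close>, these are homogeneous of degrees 0 and 1, which is the
  commutation with the scaling (\<open>leapfrog_rescale\<close>).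

  On regular functions the action is the \<open>\<int>\<close>-grading of the Laurent polynomial ring by total degree
  in the even variables: the coaction sends a function to the sum of \<open>t\<^sup>d\<close> times its part of degree
  \<open>d\<close> (\<open>Gm_coaction_grading\<close>).\<close>

section \<open>Points, transformations and cross-ratios in homogeneous coordinates\<close>

lemma proj_line_cases:
  obtains v where "v \<noteq> 0" "p = abs_proj_line v"
proof -
  have "\<exists>v. v \<noteq> 0 \<and> p = abs_proj_line v"
    by (induct p rule: proj_line.abs_induct) (auto simp: proj_rel_def)
  with that show thesis by blast
qed

lemma pgl2_cases:
  obtains A where "invertible A" "g = abs_pgl2 A"
proof -
  have "\<exists>A. invertible A \<and> g = abs_pgl2 A"
    by (induct g rule: pgl2.abs_induct) (auto simp: pgl_rel_def)
  with that show thesis by blast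
qed

lemma proj_rel_refl: "v \<noteq> 0 \<Longrightarrow> proj_rel v v"
  by (auto simp: proj_rel_def intro!: exI[of _ 1])

lemma pgl_rel_refl: "invertible A \<Longrightarrow> pgl_rel A A"
  by (auto simp: pgl_rel_def vec_eq_iff intro!: exI[of _ 1])

lemma bracket_scale [simp]: "bracket (r *s v) w = r * bracket v w" "bracket v (r *s w) = r * bracket v w"
  by (simp_all add: bracket_def algebra_simps)

lemma bracket_add [simp]:
  "bracket (u + v) w = bracket u w + bracket v w" "bracket w (u + v) = bracket w u + bracket w v"
  by (simp_all add: bracket_def algebra_simps)

lemma bracket_diff [simp]:
  "bracket (u - v) w = bracket u w - bracket v w" "bracket w (u - v) = bracket w u - bracket w v"
  by (simp_all add: bracket_def algebra_simps)

lemma bracket_self [simp]: "bracket v v = 0"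
  by (simp add: bracket_def)

lemma bracket_zero [simp]: "bracket 0 v = 0" "bracket v 0 = 0"
  by (simp_all add: bracket_def)

lemma bracket_commute: "bracket v w = - bracket w v"
  by (simp add: bracket_def)

lemma bracket_matrix: "bracket (A *v v) (A *v w) = det A * bracket v w"
  by (simp add: bracket_def matrix_vector_mult_def sum_2 det_2 algebra_simps)

lemma bracket_eq_0D:
  assumes "bracket v w = 0" "v \<noteq> 0" "w \<noteq> 0"
  shows "\<exists>c. c \<noteq> 0 \<and> w = c *s v"
proof -
  have e: "v $ 1 * w $ 2 = v $ 2 * w $ 1" using assms(1) by (simp add: bracket_def)
  have "v $ 1 \<noteq> 0 \<or> v $ 2 \<noteq> 0" using assms(2) by (auto simp: vec_eq_iff forall_2)
  then obtain c where "w = c *s v"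
  proof
    assume "v $ 1 \<noteq> 0"
    then have "w = (w $ 1 / v $ 1) *s v" using e by (simp add: vec_eq_iff forall_2 field_simps)
    then show thesis by (rule that)
  next
    assume "v $ 2 \<noteq> 0"
    then have "w = (w $ 2 / v $ 2) *s v" using e by (simp add: vec_eq_iff forall_2 field_simps)
    then show thesis by (rule that)
  qed
  with assms(3) show ?thesis by (metis vector_smult_lzero)
qed

lemma pt_eq_iff:
  assumes "v \<noteq> 0" "w \<noteq> 0"
  shows "abs_proj_line v = abs_proj_line w \<longleftrightarrow> bracket v w = 0"
proof -
  have "abs_proj_line v = abs_proj_line w \<longleftrightarrow> proj_rel v w"
    using Quotient_rel[OF Quotient_proj_line, of v w] proj_rel_refl assms by blast
  also have "\<dots> \<longleftrightarrow> bracket v w = 0"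
    using assms bracket_eq_0D[of v w] by (auto simp: proj_rel_def)
  finally show ?thesis .
qed

lemma pt_scale:
  assumes "v \<noteq> 0" "c \<noteq> 0"
  shows "abs_proj_line (c *s v) = abs_proj_line v"
  using assms by (subst pt_eq_iff) auto

lemma act_pt:
  assumes "invertible A" "v \<noteq> 0"
  shows "pgl_act (abs_pgl2 A) (abs_proj_line v) = abs_proj_line (A *v v)"
  using assms by (simp add: pgl_act.abs_eq pgl_rel_refl proj_rel_refl)

lemma cross_ratio_pt:
  assumes "a \<noteq> 0" "b \<noteq> 0" "c \<noteq> 0" "d \<noteq> 0"
  shows "cross_ratio (abs_proj_line a) (abs_proj_line b) (abs_proj_line c) (abs_proj_line d)
    = bracket a c / bracket a d * (bracket b d / bracket b c)"
  using assms by (simp add: cross_ratio.abs_eq proj_rel_refl)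

lemma basis_expansion:
  assumes "bracket u v \<noteq> 0"
  shows "x = (bracket x v / bracket u v) *s u + (bracket u x / bracket u v) *s v"
proof -
  have "bracket u v *s x = bracket x v *s u + bracket u x *s v"
    by (simp add: vec_eq_iff forall_2 bracket_def algebra_simps)
  then have "inverse (bracket u v) *s (bracket u v *s x)
    = inverse (bracket u v) *s (bracket x v *s u + bracket u x *s v)" by simp
  with assms show ?thesis
    by (simp add: vector_smult_assoc vector_add_ldistrib divide_inverse mult.commute)
qed

lemma linear_map_exists:
  fixes u v u' v' :: "'a::field ^ 2"
  assumes "bracket u v \<noteq> 0" "bracket u' v' \<noteq> 0"
  obtains A where "invertible A" "A *v u = u'" "A *v v = v'"
proof -
  define A :: "'a ^ 2 ^ 2" where
    "A = (\<chi> i j. (u' $ i * bracket (axis j 1) v + v' $ i * bracket u (axis j 1)) / bracket u v)"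
  have A: "A *v x = (bracket x v / bracket u v) *s u' + (bracket u x / bracket u v) *s v'" for x
    using assms(1)
    by (simp add: A_def vec_eq_iff forall_2 matrix_vector_mult_def sum_2 bracket_def axis_def field_simps)
  have 1: "A *v u = u'" "A *v v = v'" using assms(1) by (simp_all add: A)
  then have "det A * bracket u v = bracket u' v'" by (metis bracket_matrix)
  with assms(2) have "invertible A" by (auto simp: invertible_det_nz)
  then show thesis using 1 by (rule that)
qed

lemma matrix_eq_on_basis:
  fixes A B :: "'a::field ^ 2 ^ 2"
  assumes "bracket u v \<noteq> 0" "A *v u = B *v u" "A *v v = B *v v"
  shows "A = B"
proof -
  have "A *v x = B *v x" for x
    using assms(2,3)
    by (subst (1 2) basis_expansion[OF assms(1), of x])
      (simp add: matrix_vector_right_distrib vector_scalar_commute)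
  then show ?thesis by (simp add: matrix_eq)
qed

text \<open>Rescaling the coefficients of the third vector into the first two basis vectors puts three distinct
  points into the position \<open>u, v, u + v\<close>. This is what makes \<open>PGL\<^sub>2\<close> sharply 3-transitive.\<close>

lemma three_points_lift:
  fixes a b c :: "'a::field proj_line"
  assumes "a \<noteq> b" "a \<noteq> c" "b \<noteq> c"
  obtains u v where "bracket u v \<noteq> 0" "a = abs_proj_line u" "b = abs_proj_line v"
    "c = abs_proj_line (u + v)"
proof -
  obtain u where a: "u \<noteq> 0" "a = abs_proj_line u" by (rule proj_line_cases)
  obtain v where b: "v \<noteq> 0" "b = abs_proj_line v" by (rule proj_line_cases)
  obtain w where c: "w \<noteq> 0" "c = abs_proj_line w" by (rule proj_line_cases)
  note nz = a(1) b(1) c(1) and abc = a(2) b(2) c(2)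
  have br: "bracket u v \<noteq> 0" "bracket u w \<noteq> 0" "bracket v w \<noteq> 0"
    using assms nz by (auto simp: abc pt_eq_iff)
  then have br': "bracket w v \<noteq> 0" by (simp add: bracket_commute[of w v])
  let ?u = "(bracket w v / bracket u v) *s u" and ?v = "(bracket u w / bracket u v) *s v"
  show thesis
  proof (rule that)
    show "bracket ?u ?v \<noteq> 0" using br br' by simp
    show "a = abs_proj_line ?u" "b = abs_proj_line ?v" using nz br br' by (simp_all add: abc pt_scale)
    show "c = abs_proj_line (?u + ?v)" using basis_expansion[OF br(1), of w] abc by simp
  qed
qed

lemma nonzero_of_bracket: "bracket u v \<noteq> 0 \<Longrightarrow> u \<noteq> 0 \<and> v \<noteq> 0"
  by auto

lemma pgl_exists:
  fixes a b c a' b' c' :: "'a::field proj_line"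
  assumes "a \<noteq> b" "a \<noteq> c" "b \<noteq> c" "a' \<noteq> b'" "a' \<noteq> c'" "b' \<noteq> c'"
  obtains g where "pgl_act g a = a'" "pgl_act g b = b'" "pgl_act g c = c'"
proof -
  obtain u v where uv: "bracket u v \<noteq> 0" "a = abs_proj_line u" "b = abs_proj_line v"
    "c = abs_proj_line (u + v)"
    by (rule three_points_lift[OF assms(1-3)])
  obtain u' v' where uv': "bracket u' v' \<noteq> 0" "a' = abs_proj_line u'" "b' = abs_proj_line v'" "c' = abs_proj_line (u' + v')"
    by (rule three_points_lift[OF assms(4-6)])
  obtain A where A: "invertible A" "A *v u = u'" "A *v v = v'"
    using linear_map_exists uv(1) uv'(1) by blast
  have "u \<noteq> 0" "v \<noteq> 0" "u + v \<noteq> 0"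
    using uv(1) nonzero_of_bracket nonzero_of_bracket[of u "u + v"] by auto
  then show thesis using A by (intro that[of "abs_pgl2 A"]) (auto simp: uv uv' act_pt matrix_vector_right_distrib)
qed

text \<open>Representing matrices \<open>A, B\<close> satisfy \<open>B u = k\<^sub>1 A u\<close>, \<open>B v = k\<^sub>2 A v\<close> and \<open>B (u + v) = k\<^sub>3 A (u + v)\<close>.
  As \<open>A u, A v\<close> are independent, all three factors agree, so \<open>B\<close> is a multiple of \<open>A\<close>.\<close>

lemma pgl_eqI:
  fixes a b c :: "'a::field proj_line"
  assumes "a \<noteq> b" "a \<noteq> c" "b \<noteq> c"
    and "pgl_act g a = pgl_act h a" "pgl_act g b = pgl_act h b" "pgl_act g c = pgl_act h c"
  shows "g = h"
proof -
  obtain u v where uv: "bracket u v \<noteq> 0" "a = abs_proj_line u" "b = abs_proj_line v"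
    "c = abs_proj_line (u + v)"
    by (rule three_points_lift[OF assms(1-3)])
  have nz: "u \<noteq> 0" "v \<noteq> 0" "u + v \<noteq> 0"
    using uv(1) nonzero_of_bracket nonzero_of_bracket[of u "u + v"] by auto
  obtain A where A: "invertible A" "g = abs_pgl2 A" by (rule pgl2_cases)
  obtain B where B: "invertible B" "h = abs_pgl2 B" by (rule pgl2_cases)
  have parallel: "\<exists>k. k \<noteq> 0 \<and> B *v x = k *s (A *v x)"
    if "x \<noteq> 0" "pgl_act g (abs_proj_line x) = pgl_act h (abs_proj_line x)" for x
    using that A B by (intro bracket_eq_0D) (auto simp: act_pt pt_eq_iff invertible_mult_vec_nonzero)
  obtain k1 where k1: "k1 \<noteq> 0" "B *v u = k1 *s (A *v u)" using parallel[OF nz(1)] assms uv by auto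
  obtain k2 where k2: "k2 \<noteq> 0" "B *v v = k2 *s (A *v v)" using parallel[OF nz(2)] assms uv by auto
  obtain k3 where k3: "k3 \<noteq> 0" "B *v (u + v) = k3 *s (A *v (u + v))" using parallel[OF nz(3)] assms uv by auto
  \<comment> \<open>Expand the image of \<open>u + v\<close> in two ways; the brackets below compare coefficients.\<close>
  have e: "k1 *s (A *v u) + k2 *s (A *v v) = k3 *s (A *v u) + k3 *s (A *v v)"
    using k1(2) k2(2) k3(2) by (simp add: matrix_vector_right_distrib vector_add_ldistrib)
  have d: "bracket (A *v u) (A *v v) \<noteq> 0"
    using uv(1) A(1) by (simp add: bracket_matrix invertible_det_nz)
  have "k1 * bracket (A *v u) (A *v v) = k3 * bracket (A *v u) (A *v v)"
    using arg_cong[OF e, of "\<lambda>x. bracket x (A *v v)"] by simp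
  moreover have "k2 * bracket (A *v u) (A *v v) = k3 * bracket (A *v u) (A *v v)"
    using arg_cong[OF e, of "\<lambda>x. bracket (A *v u) x"] by simp
  ultimately have k: "k2 = k1" using d by simp
  have sc: "(\<chi> i. k1 *s A $ i) *v x = k1 *s (A *v x)" for x
    using scale_matrix_vector[of k1 A 1 x] by simp
  have "B = (\<chi> i. k1 *s A $ i)"
    by (rule matrix_eq_on_basis[OF uv(1)]) (simp_all add: sc k1(2) k2(2) k)
  then have "pgl_rel A B" using A B k1 by (auto simp: pgl_rel_def)
  then show ?thesis using A(2) B(2) by (simp add: Quotient_rel_abs[OF Quotient_pgl2])
qed

lemma pgl_act_inj: "pgl_act g a = pgl_act g b \<longleftrightarrow> a = b"
proof -
  obtain A where A: "invertible A" "g = abs_pgl2 A" by (rule pgl2_cases)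
  obtain u where a: "u \<noteq> 0" "a = abs_proj_line u" by (rule proj_line_cases)
  obtain v where b: "v \<noteq> 0" "b = abs_proj_line v" by (rule proj_line_cases)
  from A a b show ?thesis
    by (simp add: act_pt pt_eq_iff invertible_mult_vec_nonzero bracket_matrix invertible_det_nz)
qed

lemma pgl_act_mult: "pgl_act (pgl_mult g h) a = pgl_act g (pgl_act h a)"
proof -
  obtain A where A: "invertible A" "g = abs_pgl2 A" by (rule pgl2_cases)
  obtain B where B: "invertible B" "h = abs_pgl2 B" by (rule pgl2_cases)
  obtain u where "u \<noteq> 0" "a = abs_proj_line u" by (rule proj_line_cases)
  with A B show ?thesis
    by (simp add: pgl_mult.abs_eq pgl_rel_refl act_pt invertible_mult_vec_nonzero
        invertible_mult matrix_vector_mul_assoc)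
qed

lemma pgl_act_inv: "pgl_act (pgl_inv g) (pgl_act g a) = a"
proof -
  obtain A where A: "invertible A" "g = abs_pgl2 A" by (rule pgl2_cases)
  moreover have "invertible (matrix_inv A)"
    using matrix_inv_props[OF A(1)] unfolding invertible_def by blast
  moreover obtain u where "u \<noteq> 0" "a = abs_proj_line u" by (rule proj_line_cases)
  ultimately show ?thesis
    by (simp add: pgl_inv.abs_eq pgl_rel_refl act_pt invertible_mult_vec_nonzero
        matrix_vector_mul_assoc matrix_inv_props)
qed

lemma cross_ratio_pgl_act:
  "cross_ratio (pgl_act g a) (pgl_act g b) (pgl_act g c) (pgl_act g d) = cross_ratio a b c d"
proof -
  obtain A where A: "invertible A" "g = abs_pgl2 A" by (rule pgl2_cases)
  obtain u where a: "u \<noteq> 0" "a = abs_proj_line u" by (rule proj_line_cases)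
  obtain v where b: "v \<noteq> 0" "b = abs_proj_line v" by (rule proj_line_cases)
  obtain w where c: "w \<noteq> 0" "c = abs_proj_line w" by (rule proj_line_cases)
  obtain x where d: "x \<noteq> 0" "d = abs_proj_line x" by (rule proj_line_cases)
  with A a b c d show ?thesis
    by (simp add: act_pt cross_ratio_pt invertible_mult_vec_nonzero bracket_matrix invertible_det_nz)
qed

lemma cross_ratio_nonzero:
  assumes "a \<noteq> c" "a \<noteq> d" "b \<noteq> d" "b \<noteq> c"
  shows "cross_ratio a b c d \<noteq> 0"
proof -
  obtain u where a: "u \<noteq> 0" "a = abs_proj_line u" by (rule proj_line_cases)
  obtain v where b: "v \<noteq> 0" "b = abs_proj_line v" by (rule proj_line_cases)
  obtain w where c: "w \<noteq> 0" "c = abs_proj_line w" by (rule proj_line_cases)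
  obtain x where d: "x \<noteq> 0" "d = abs_proj_line x" by (rule proj_line_cases)
  with assms a b c d show ?thesis by (simp add: cross_ratio_pt pt_eq_iff)
qed

lemma plucker: "bracket a b * bracket d e = bracket a d * bracket b e - bracket a e * bracket b d"
  by (simp add: bracket_def algebra_simps)

text \<open>For the brackets of five points the conclusion is one side of the Pluecker relation, so it forces
  two of the points to coincide.\<close>

lemma cross_cancel:
  fixes A B x y x' y' :: "'a::field"
  assumes "A \<noteq> 0" "B \<noteq> 0" "x \<noteq> 0" "x' \<noteq> 0" "A / x * (y / B) = A / x' * (y' / B)"
  shows "x * y' - x' * y = 0"
proof -
  have "A / x * (y / B) = (A / B) * (y / x)" "A / x' * (y' / B) = (A / B) * (y' / x')" by simp_all
  with assms(5) have "(A / B) * (y / x) = (A / B) * (y' / x')" by metis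
  moreover have "A / B \<noteq> 0" using assms by simp
  ultimately have "y / x = y' / x'" by (metis mult_left_cancel)
  with assms show ?thesis by (simp add: frac_eq_eq mult.commute)
qed

lemma cross_ratio_inj_fourth:
  assumes "a \<noteq> b" "a \<noteq> c" "b \<noteq> c" "a \<noteq> d" "a \<noteq> d'"
    and "cross_ratio a b c d = cross_ratio a b c d'"
  shows "d = d'"
proof -
  obtain u where a: "u \<noteq> 0" "a = abs_proj_line u" by (rule proj_line_cases)
  obtain v where b: "v \<noteq> 0" "b = abs_proj_line v" by (rule proj_line_cases)
  obtain w where c: "w \<noteq> 0" "c = abs_proj_line w" by (rule proj_line_cases)
  obtain x where d: "x \<noteq> 0" "d = abs_proj_line x" by (rule proj_line_cases)
  obtain y where d': "y \<noteq> 0" "d' = abs_proj_line y" by (rule proj_line_cases)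
  note nz = a(1) b(1) c(1) d(1) d'(1) and e = a(2) b(2) c(2) d(2) d'(2)
  have br: "bracket u w \<noteq> 0" "bracket v w \<noteq> 0" "bracket u x \<noteq> 0" "bracket u y \<noteq> 0"
    using assms(1-5) nz by (simp_all add: e pt_eq_iff)
  have "bracket u w / bracket u x * (bracket v x / bracket v w)
    = bracket u w / bracket u y * (bracket v y / bracket v w)"
    using assms(6) unfolding e cross_ratio_pt[OF nz(1,2,3,4)] cross_ratio_pt[OF nz(1,2,3,5)] .
  from cross_cancel[OF br this] have "bracket u x * bracket v y - bracket u y * bracket v x = 0" .
  then have "bracket u v * bracket x y = 0" by (simp only: plucker[of u v x y])
  with nz assms show ?thesis by (simp add: e pt_eq_iff)
qed

lemma cross_ratio_inj_third:
  assumes "a \<noteq> b" "a \<noteq> d" "b \<noteq> d" "b \<noteq> c" "b \<noteq> c'"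
    and "cross_ratio a b c d = cross_ratio a b c' d"
  shows "c = c'"
proof -
  obtain u where a: "u \<noteq> 0" "a = abs_proj_line u" by (rule proj_line_cases)
  obtain v where b: "v \<noteq> 0" "b = abs_proj_line v" by (rule proj_line_cases)
  obtain w where d: "w \<noteq> 0" "d = abs_proj_line w" by (rule proj_line_cases)
  obtain x where c: "x \<noteq> 0" "c = abs_proj_line x" by (rule proj_line_cases)
  obtain y where c': "y \<noteq> 0" "c' = abs_proj_line y" by (rule proj_line_cases)
  note nz = a(1) b(1) d(1) c(1) c'(1) and e = a(2) b(2) d(2) c(2) c'(2)
  have br: "bracket v w \<noteq> 0" "bracket u w \<noteq> 0" "bracket v x \<noteq> 0" "bracket v y \<noteq> 0"
    using assms(1-5) nz by (simp_all add: e pt_eq_iff)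
  have "bracket u x / bracket u w * (bracket v w / bracket v x)
    = bracket u y / bracket u w * (bracket v w / bracket v y)"
    using assms(6) unfolding e cross_ratio_pt[OF nz(1,2,4,3)] cross_ratio_pt[OF nz(1,2,5,3)] .
  then have "bracket v w / bracket v x * (bracket u x / bracket u w)
    = bracket v w / bracket v y * (bracket u y / bracket u w)"
    by (simp only: mult.commute)
  from cross_cancel[OF br this] have "bracket v x * bracket u y - bracket v y * bracket u x = 0" .
  then have "bracket u v * bracket x y = 0" by (subst plucker) (simp add: mult.commute)
  with nz assms show ?thesis by (simp add: e pt_eq_iff)
qed

section \<open>Twisted polygons and second-order recurrences\<close>

definition generic :: "(int \<Rightarrow> 'a::field proj_line) \<Rightarrow> bool" where
  "generic p \<longleftrightarrow> (\<forall>i. p i \<noteq> p (i + 1) \<and> p (i + 1) \<noteq> p (i + 2) \<and> p i \<noteq> p (i + 2))"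

definition consecutive_cross_ratio :: "(int \<Rightarrow> 'a::field proj_line) \<Rightarrow> int \<Rightarrow> 'a" where
  "consecutive_cross_ratio p k = cross_ratio (p k) (p (k + 1)) (p (k - 1)) (p (k + 2))"

lemma polygons_iff:
  "(p, M) \<in> polygons m \<longleftrightarrow> (\<forall>i. p (i + int m) = pgl_act M (p i)) \<and> generic p"
  by (simp add: polygons_def generic_def)

lemma polygonsD:
  assumes "(p, M) \<in> polygons m"
  shows "generic p" "p (i + int m) = pgl_act M (p i)"
  using assms by (simp_all add: polygons_iff)

lemma genericD:
  assumes "generic p"
  shows "p k \<noteq> p (k + 1)" "p k \<noteq> p (k + 2)" "p (k + 1) \<noteq> p (k + 2)"
    "p (k + 1) \<noteq> p (k + 3)" "p (k + 2) \<noteq> p (k + 3)"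
proof -
  show "p k \<noteq> p (k + 1)" "p k \<noteq> p (k + 2)" "p (k + 1) \<noteq> p (k + 2)"
    using assms by (auto simp: generic_def)
  have "p (k + 1) \<noteq> p (k + 1 + 2)" "p (k + 1 + 1) \<noteq> p (k + 1 + 2)"
    using assms unfolding generic_def by blast+
  then show "p (k + 1) \<noteq> p (k + 3)" "p (k + 2) \<noteq> p (k + 3)" by (simp_all add: add.assoc)
qed

lemma generic_pgl_act: "generic p \<Longrightarrow> generic (\<lambda>i. pgl_act g (p i))"
  by (simp add: generic_def pgl_act_inj)

lemma consecutive_cross_ratio_pgl_act:
  "consecutive_cross_ratio (\<lambda>i. pgl_act g (p i)) = consecutive_cross_ratio p"
  by (simp add: consecutive_cross_ratio_def cross_ratio_pgl_act fun_eq_iff)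

lemma consecutive_cross_ratio_shift:
  "consecutive_cross_ratio p (k + 1) = cross_ratio (p (k + 1)) (p (k + 2)) (p k) (p (k + 3))"
  by (simp add: consecutive_cross_ratio_def add.assoc)

lemma consecutive_cross_ratio_nonzero:
  assumes "generic p"
  shows "consecutive_cross_ratio p k \<noteq> 0"
proof -
  have "consecutive_cross_ratio p (k - 1 + 1) \<noteq> 0"
    unfolding consecutive_cross_ratio_shift
    by (intro cross_ratio_nonzero genericD(1)[OF assms, THEN not_sym] genericD[OF assms, of "k - 1"]
        genericD(2)[OF assms, THEN not_sym])
  then show ?thesis by simp
qed

lemma int_iff_induct:
  fixes k :: int
  assumes "Q 0" "\<And>k. Q k \<longleftrightarrow> Q (k + 1)"
  shows "Q k"
proof (induct k rule: int_induct[of _ 0])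
  case (step2 i)
  then show ?case using assms(2)[of "i - 1"] by simp
qed (use assms in auto)

text \<open>The cross-ratio of four consecutive vertices determines the last of them from the first three, and
  the first from the last three; so agreement of three consecutive vertices propagates in both
  directions.\<close>

lemma generic_eqI:
  assumes p: "generic p" and q: "generic q"
    and eq: "consecutive_cross_ratio p = consecutive_cross_ratio q"
    and start: "p 0 = q 0" "p 1 = q 1" "p 2 = q 2"
  shows "p = q"
proof
  fix k
  have "p k = q k \<and> p (k + 1) = q (k + 1) \<and> p (k + 2) = q (k + 2)"
  proof (induct k rule: int_iff_induct)
    case 1
    show ?case using start by simp
  next
    case (2 k)
    have cr: "cross_ratio (p (k + 1)) (p (k + 2)) (p k) (p (k + 3))
      = cross_ratio (q (k + 1)) (q (k + 2)) (q k) (q (k + 3))"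
      using fun_cong[OF eq, of "k + 1"] by (simp only: consecutive_cross_ratio_shift)
    note p' = genericD[OF p, of k] and q' = genericD[OF q, of k]
    show ?case
    proof
      assume *: "p k = q k \<and> p (k + 1) = q (k + 1) \<and> p (k + 2) = q (k + 2)"
      have "p (k + 3) = q (k + 3)"
        by (rule cross_ratio_inj_fourth[of "p (k + 1)" "p (k + 2)" "p k"]) (use * cr p' q' in auto)
      with * show "p (k + 1) = q (k + 1) \<and> p (k + 1 + 1) = q (k + 1 + 1) \<and> p (k + 1 + 2) = q (k + 1 + 2)"
        by (simp add: add.assoc)
    next
      assume "p (k + 1) = q (k + 1) \<and> p (k + 1 + 1) = q (k + 1 + 1) \<and> p (k + 1 + 2) = q (k + 1 + 2)"
      then have *: "p (k + 1) = q (k + 1)" "p (k + 2) = q (k + 2)" "p (k + 3) = q (k + 3)"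
        by (simp_all add: add.assoc)
      have "p k = q k"
        by (rule cross_ratio_inj_third[of "p (k + 1)" "p (k + 2)" "p (k + 3)"])
          (use * cr p' q' p'(2)[THEN not_sym] q'(2)[THEN not_sym] in simp_all)
      with * show "p k = q k \<and> p (k + 1) = q (k + 1) \<and> p (k + 2) = q (k + 2)" by simp
    qed
  qed
  then show "p k = q k" by simp
qed

text \<open>The normalised lifts of a polygon with consecutive cross-ratios \<open>c\<close>.\<close>

definition recurrent :: "(int \<Rightarrow> 'a::field) \<Rightarrow> (int \<Rightarrow> 'a ^ 2) \<Rightarrow> bool" where
  "recurrent c v \<longleftrightarrow> (\<forall>k. v (k + 2) = v (k + 1) - c k *s v k)"

text \<open>Forward iteration of \<open>F\<close> and backward iteration of its sections \<open>G\<close> give an orbit that is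
  infinite in both directions.\<close>

lemma orbit_exists:
  fixes F G :: "int \<Rightarrow> 'b \<Rightarrow> 'b"
  assumes FG: "\<And>k x. F k (G k x) = x"
  shows "\<exists>g. g 0 = x \<and> (\<forall>k. g (k + 1) = F k (g k))"
proof -
  define f where "f = rec_nat x (\<lambda>n. F (int n))"
  define h where "h = rec_nat x (\<lambda>n. G (- int n - 1))"
  define g where "g k = (if k \<ge> 0 then f (nat k) else h (nat (- k)))" for k
  have "g (k + 1) = F k (g k)" for k
  proof (cases "k \<ge> 0")
    case True
    then have "nat (k + 1) = Suc (nat k)" by simp
    with True show ?thesis by (simp add: g_def f_def)
  next
    case False
    define j where "j = nat (- k - 1)"
    from False have j: "nat (- k) = Suc j" "- int j - 1 = k" "nat (- (k + 1)) = j"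
      by (simp_all add: j_def)
    have "g k = G k (h j)"
      using False by (simp add: g_def h_def j)
    moreover have "g (k + 1) = h j"
      using False j by (auto simp: g_def f_def h_def)
    ultimately show ?thesis by (simp add: FG)
  qed
  moreover have "g 0 = x" by (simp add: g_def f_def)
  ultimately show ?thesis by blast
qed

text \<open>The recurrence is a first-order system for the pairs \<open>(v\<^sub>k, v\<^sub>k\<^sub>+\<^sub>1)\<close>, whose steps are invertible
  because \<open>c\<^sub>k \<noteq> 0\<close>.\<close>

lemma recurrent_exists:
  fixes c :: "int \<Rightarrow> 'a::field" and a b :: "'a ^ 2"
  assumes "\<And>k. c k \<noteq> 0"
  obtains v where "recurrent c v" "v 0 = a" "v 1 = b"
proof -
  let ?F = "\<lambda>k (x :: ('a ^ 2) \<times> ('a ^ 2)). (snd x, snd x - c k *s fst x)"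
  let ?G = "\<lambda>k (x :: ('a ^ 2) \<times> ('a ^ 2)). (inverse (c k) *s (fst x - snd x), fst x)"
  have "?F k (?G k x) = x" for k x
    using assms[of k] by (simp add: vector_smult_assoc)
  from orbit_exists[of ?F ?G, OF this]
  obtain g where g: "g 0 = (a, b)" "\<And>k. g (k + 1) = ?F k (g k)" by blast
  have fst_g: "fst (g (k + 1)) = snd (g k)" for k unfolding g(2) by simp
  have "fst (g (k + 1 + 1)) = fst (g (k + 1)) - c k *s fst (g k)" for k
    unfolding fst_g unfolding g(2) by simp
  then have "recurrent c (\<lambda>k. fst (g k))"
    by (simp add: recurrent_def add.assoc)
  moreover have "fst (g 1) = b" using fst_g[of 0] g(1) by simp
  ultimately show thesis using g(1) by (intro that[of "\<lambda>k. fst (g k)"]) simp_all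
qed

lemma recurrent_unique:
  assumes c: "\<And>k. c k \<noteq> 0" and v: "recurrent c v" and w: "recurrent c w"
    and start: "v 0 = w 0" "v 1 = w 1"
  shows "v = w"
proof
  fix k
  have "v k = w k \<and> v (k + 1) = w (k + 1)"
  proof (induct k rule: int_iff_induct)
    case 1
    show ?case using start by simp
  next
    case (2 k)
    have "v (k + 2) = v (k + 1) - c k *s v k" "w (k + 2) = w (k + 1) - c k *s w k"
      using v w by (auto simp: recurrent_def)
    then show ?case using c[of k] by (auto simp: add.assoc)
  qed
  then show "v k = w k" by simp
qed

lemma recurrent_bracket:
  assumes "recurrent c v"
  shows "bracket (v (k + 1)) (v (k + 2)) = c k * bracket (v k) (v (k + 1))"
    and "bracket (v k) (v (k + 2)) = bracket (v k) (v (k + 1))"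
  using assms bracket_commute[of "v (k + 1)" "v k"] by (simp_all add: recurrent_def)

lemma recurrent_bracket_nonzero:
  assumes "\<And>k. c k \<noteq> 0" "recurrent c v" "bracket (v 0) (v 1) \<noteq> 0"
  shows "bracket (v k) (v (k + 1)) \<noteq> 0"
proof (induct k rule: int_iff_induct)
  case (2 k)
  then show ?case using recurrent_bracket(1)[OF assms(2), of k] assms(1)[of k] by (simp add: add.assoc)
qed (use assms in simp)

text \<open>The brackets of consecutive vectors satisfy \<open>W\<^sub>k\<^sub>+\<^sub>1 = c\<^sub>k W\<^sub>k\<close>, and vectors two steps apart have bracket
  \<open>[v\<^sub>k, v\<^sub>k\<^sub>+\<^sub>2] = W\<^sub>k\<close>. So all of them are nonzero, and the \<open>k\<close>-th cross-ratio is \<open>W\<^sub>k\<^sub>+\<^sub>1 / W\<^sub>k\<close>.\<close>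

lemma
  assumes c: "\<And>k. c k \<noteq> 0" and v: "recurrent c v" and v01: "bracket (v 0) (v 1) \<noteq> 0"
  shows generic_recurrent: "generic (\<lambda>k. abs_proj_line (v k))"
    and consecutive_cross_ratio_recurrent: "consecutive_cross_ratio (\<lambda>k. abs_proj_line (v k)) = c"
proof -
  note W = recurrent_bracket_nonzero[OF c v v01]
  have nz: "v k \<noteq> 0" for k using W[of k] by auto
  show "generic (\<lambda>k. abs_proj_line (v k))"
    using W nz c by (auto simp: generic_def pt_eq_iff recurrent_bracket[OF v])
  show "consecutive_cross_ratio (\<lambda>k. abs_proj_line (v k)) = c"
  proof
    fix k
    have shift: "k - 1 + (1 :: int) = k" "k - 1 + (2 :: int) = k + 1" by simp_all
    have "bracket (v k) (v (k - 1)) = - bracket (v (k - 1)) (v k)"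
      "bracket (v (k + 1)) (v (k - 1)) = - bracket (v (k - 1)) (v k)"
      using recurrent_bracket(2)[OF v, of "k - 1", unfolded shift] bracket_commute[of "v k" "v (k - 1)"]
        bracket_commute[of "v (k + 1)" "v (k - 1)"] by simp_all
    then show "consecutive_cross_ratio (\<lambda>k. abs_proj_line (v k)) k = c k"
      using W[of k] W[of "k - 1", unfolded shift]
      by (simp add: consecutive_cross_ratio_def cross_ratio_pt nz recurrent_bracket[OF v])
  qed
qed

text \<open>Choose the first two vectors so that the recurrence also yields the third vertex; the polygon of
  the solution then equals \<open>p\<close> because it has the same cross-ratios.\<close>

lemma lift_exists:
  assumes "generic p"
  obtains v where "recurrent (consecutive_cross_ratio p) v" "bracket (v 0) (v 1) \<noteq> 0"
    "p = (\<lambda>k. abs_proj_line (v k))"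
proof -
  let ?c = "consecutive_cross_ratio p"
  have c: "?c k \<noteq> 0" for k by (rule consecutive_cross_ratio_nonzero[OF assms])
  obtain a b where ab: "bracket a b \<noteq> 0" "p 0 = abs_proj_line a" "p 1 = abs_proj_line b"
    "p 2 = abs_proj_line (a + b)"
    by (rule three_points_lift[of "p 0" "p 1" "p 2"]) (use genericD[OF assms, of 0] in auto)
  \<comment> \<open>The sign and the factor make \<open>v\<^sub>2 = v\<^sub>1 - c\<^sub>0 v\<^sub>0 = b + a\<close>.\<close>
  define a' where "a' = (- inverse (?c 0)) *s a"
  obtain v where v: "recurrent ?c v" "v 0 = a'" "v 1 = b"
    by (rule recurrent_exists[OF c])
  have v01: "bracket (v 0) (v 1) \<noteq> 0" using ab(1) c[of 0] by (simp only: v a'_def bracket_scale mult_eq_0_iff) simp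
  have "a \<noteq> 0" using ab(1) by auto
  have v2: "v 2 = a + b"
  proof -
    have "v (0 + 2) = v (0 + 1) - ?c 0 *s v 0" using v(1) unfolding recurrent_def by blast
    also have "\<dots> = a + b"
      using c[of 0] by (simp add: v(2,3) a'_def vector_smult_assoc vec_eq_iff)
    finally show ?thesis by simp
  qed
  have "p = (\<lambda>k. abs_proj_line (v k))"
  proof (rule generic_eqI[OF assms generic_recurrent[OF c v(1) v01]])
    show "?c = consecutive_cross_ratio (\<lambda>k. abs_proj_line (v k))"
      by (simp add: consecutive_cross_ratio_recurrent[OF c v(1) v01])
    show "p 0 = abs_proj_line (v 0)"
      unfolding v(2) a'_def ab(2) by (rule pt_scale[symmetric]) (use \<open>a \<noteq> 0\<close> c[of 0] in auto)
  qed (simp_all add: v v2 ab)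
  with v(1) v01 show thesis by (rule that)
qed

lemma consecutive_cross_ratio_periodic:
  assumes "(p, M) \<in> polygons m"
  shows "consecutive_cross_ratio p (k + int m) = consecutive_cross_ratio p k"
proof -
  have "p (k + int m + j) = pgl_act M (p (k + j))" for j
  proof -
    have "p (k + j + int m) = pgl_act M (p (k + j))"
      using assms by (simp only: polygons_iff)
    then show ?thesis by (simp add: algebra_simps)
  qed
  from this[of 0] this[of 1] this[of "-1"] this[of 2]
  have "p (k + int m) = pgl_act M (p k)" "p (k + int m + 1) = pgl_act M (p (k + 1))"
    "p (k + int m - 1) = pgl_act M (p (k - 1))" "p (k + int m + 2) = pgl_act M (p (k + 2))"
    by simp_all
  then show ?thesis
    by (simp only: consecutive_cross_ratio_def cross_ratio_pgl_act)
qed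

text \<open>Move three vertices of one polygon to those of the other. The remaining vertices follow because of
  the cross-ratios, and the monodromies are conjugate because each is determined by its effect on
  three vertices.\<close>

lemma polygon_equiv_iff:
  "((p, M), (q, N)) \<in> polygon_equiv m \<longleftrightarrow>
    (p, M) \<in> polygons m \<and> (q, N) \<in> polygons m \<and> consecutive_cross_ratio p = consecutive_cross_ratio q"
proof
  assume "((p, M), (q, N)) \<in> polygon_equiv m"
  then show "(p, M) \<in> polygons m \<and> (q, N) \<in> polygons m \<and> consecutive_cross_ratio p = consecutive_cross_ratio q"
    by (auto simp: polygon_equiv_def pgl_act_polygon_def consecutive_cross_ratio_pgl_act)
next
  assume *: "(p, M) \<in> polygons m \<and> (q, N) \<in> polygons m \<and> consecutive_cross_ratio p = consecutive_cross_ratio q"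
  note p = polygonsD[OF *[THEN conjunct1]] and q = polygonsD[OF *[THEN conjunct2, THEN conjunct1]]
  obtain g where g: "pgl_act g (p 0) = q 0" "pgl_act g (p 1) = q 1" "pgl_act g (p 2) = q 2"
    by (rule pgl_exists[of "p 0" "p 1" "p 2" "q 0" "q 1" "q 2"])
      (use genericD[OF p(1), of 0] genericD[OF q(1), of 0] in auto)
  have "(\<lambda>i. pgl_act g (p i)) = q"
    using *[THEN conjunct2, THEN conjunct2] g by (intro generic_eqI generic_pgl_act p(1) q(1))
      (simp_all add: consecutive_cross_ratio_pgl_act)
  then have gp: "pgl_act g (p i) = q i" for i by (rule fun_cong)
  have "pgl_act N (q i) = pgl_act (pgl_mult (pgl_mult g M) (pgl_inv g)) (q i)" for i
  proof -
    have "pgl_act N (q i) = pgl_act g (pgl_act M (p i))"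
      unfolding p(2)[symmetric] q(2)[symmetric] gp ..
    also have "\<dots> = pgl_act (pgl_mult (pgl_mult g M) (pgl_inv g)) (q i)"
      unfolding gp[of i, symmetric] pgl_act_mult pgl_act_inv ..
    finally show ?thesis .
  qed
  then have "N = pgl_mult (pgl_mult g M) (pgl_inv g)"
    using genericD(1-3)[OF q(1), of 0] by (intro pgl_eqI[of "q 0" "q 1" "q 2"]) simp_all
  then have "(q, N) = pgl_act_polygon g (p, M)"
    by (simp add: pgl_act_polygon_def gp)
  with * show "((p, M), (q, N)) \<in> polygon_equiv m" unfolding polygon_equiv_def by blast
qed

text \<open>By periodicity of \<open>c\<close>, translation by \<open>m\<close> maps solutions of the recurrence to solutions. A solution
  is determined by its first two vectors, which here form a basis, so the translation is a linear map:
  the monodromy.\<close>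

lemma polygon_with_cross_ratios:
  fixes c :: "int \<Rightarrow> 'a::field"
  assumes c: "\<And>k. c k \<noteq> 0" and per: "\<And>k. c (k + int m) = c k"
  obtains p M where "(p, M) \<in> polygons m" "consecutive_cross_ratio p = c"
proof -
  obtain v :: "int \<Rightarrow> 'a ^ 2" where v: "recurrent c v" "v 0 = axis 1 1" "v 1 = axis 2 1"
    by (rule recurrent_exists[OF c])
  have v01: "bracket (v 0) (v 1) \<noteq> 0" by (simp add: v bracket_def axis_def)
  note W = recurrent_bracket_nonzero[OF c v(1) v01]
  have nz: "v k \<noteq> 0" for k using W[of k] by auto
  obtain A where A: "invertible A" "A *v v 0 = v (int m)" "A *v v 1 = v (int m + 1)"
    by (rule linear_map_exists[OF v01 W[of "int m"]])
  have "(\<lambda>k. v (k + int m)) = (\<lambda>k. A *v v k)"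
  proof (rule recurrent_unique[OF c])
    have "v (k + int m + 2) = v (k + int m + 1) - c k *s v (k + int m)" for k
      using v(1) per unfolding recurrent_def by metis
    then show "recurrent c (\<lambda>k. v (k + int m))" by (simp add: recurrent_def algebra_simps)
    show "recurrent c (\<lambda>k. A *v v k)"
      using v(1) by (simp add: recurrent_def matrix_vector_mult_diff_distrib vector_scalar_commute)
  qed (use A in \<open>auto simp: add.commute\<close>)
  then have "v (k + int m) = A *v v k" for k by (rule fun_cong)
  then have "((\<lambda>k. abs_proj_line (v k)), abs_pgl2 A) \<in> polygons m"
    by (simp add: polygons_iff generic_recurrent[OF c v(1) v01] act_pt A nz)
  then show thesis
    using consecutive_cross_ratio_recurrent[OF c v(1) v01] by (rule that)
qed

section \<open>Coordinates on the moduli space\<close>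

lemma polygon_class_iff:
  "(q, N) \<in> polygon_class m (p, M) \<longleftrightarrow>
    (p, M) \<in> polygons m \<and> (q, N) \<in> polygons m \<and> consecutive_cross_ratio p = consecutive_cross_ratio q"
  by (simp add: polygon_class_def polygon_equiv_iff)

lemma polygon_class_in_moduli: "(p, M) \<in> polygons m \<Longrightarrow> polygon_class m (p, M) \<in> moduli m"
  unfolding moduli_def polygon_class_def by (rule quotientI)

lemma moduli_cases:
  assumes "C \<in> moduli m"
  obtains p M where "(p, M) \<in> polygons m" "C = polygon_class m (p, M)"
  using assms unfolding moduli_def polygon_class_def by (auto elim!: quotientE)

lemma coordinate_polygon_class:
  assumes "(p, M) \<in> polygons m"
  shows "coordinate (polygon_class m (p, M)) = consecutive_cross_ratio p"
proof
  fix k :: int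
  let ?f = "\<lambda>(p, M :: 'a pgl2). cross_ratio (p k) (p (k + 1)) (p (k - 1)) (p (k + 2))"
  have "the_elem (?f ` polygon_class m (p, M)) = ?f (p, M)"
  proof (rule the_elem_image_unique)
    show "polygon_class m (p, M) \<noteq> {}" using assms polygon_class_iff by blast
    fix Q assume "Q \<in> polygon_class m (p, M)"
    then have "consecutive_cross_ratio p k = consecutive_cross_ratio (fst Q) k"
      using polygon_class_iff[of "fst Q" "snd Q" m p M] by simp
    then show "?f Q = ?f (p, M)" by (simp add: split_beta consecutive_cross_ratio_def)
  qed
  then show "coordinate (polygon_class m (p, M)) k = consecutive_cross_ratio p k"
    by (simp add: coordinate_def consecutive_cross_ratio_def)
qed

lemma moduli_eqI:
  assumes "C \<in> moduli m" "D \<in> moduli m" "coordinate C = coordinate D"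
  shows "C = D"
proof -
  obtain p M where p: "(p, M) \<in> polygons m" "C = polygon_class m (p, M)"
    by (rule moduli_cases[OF assms(1)])
  obtain q N where q: "(q, N) \<in> polygons m" "D = polygon_class m (q, N)"
    by (rule moduli_cases[OF assms(2)])
  have "consecutive_cross_ratio p = consecutive_cross_ratio q"
    using assms(3) p q by (simp add: coordinate_polygon_class)
  then show ?thesis using p q by (auto simp: polygon_class_iff)
qed

lemma
  assumes "C \<in> moduli m"
  shows coordinate_nonzero: "coordinate C k \<noteq> 0"
    and coordinate_periodic: "coordinate C (k + int m) = coordinate C k"
proof -
  obtain p M where p: "(p, M) \<in> polygons m" "C = polygon_class m (p, M)"
    by (rule moduli_cases[OF assms])
  show "coordinate C k \<noteq> 0" "coordinate C (k + int m) = coordinate C k"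
    unfolding p(2) coordinate_polygon_class[OF p(1)]
    by (rule consecutive_cross_ratio_nonzero[OF polygonsD(1)[OF p(1)]])
      (rule consecutive_cross_ratio_periodic[OF p(1)])
qed

lemma moduli_exists:
  fixes c :: "int \<Rightarrow> 'a::field"
  assumes "\<And>k. c k \<noteq> 0" "\<And>k. c (k + int m) = c k"
  obtains C where "C \<in> moduli m" "coordinate C = c"
proof -
  obtain p M where p: "(p, M) \<in> polygons m" "consecutive_cross_ratio p = c"
    by (rule polygon_with_cross_ratios[of c m, OF assms])
  show thesis
    using polygon_class_in_moduli[OF p(1)] coordinate_polygon_class[OF p(1)] p(2)
    by (intro that[of "polygon_class m (p, M)"]) simp_all
qed

lemma o_minus_eq: "o_minus C i = coordinate C (2 * i)"
proof -
  have e: "2 * (i - 1) + 1 = 2 * i - 1" "2 * (i + 1) = 2 * i + 2" by simp_all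
  show ?thesis by (simp only: o_minus_def coordinate_def Let_def e)
qed

lemma o_plain_eq: "o_plain C i = coordinate C (2 * i + 1)"
proof -
  have e: "2 * (i + 1) = 2 * i + 1 + 1" "2 * i + 1 - 1 = 2 * i" "2 * i + 1 + 1 + 1 = 2 * i + 1 + 2" by simp_all
  show ?thesis by (simp only: o_plain_def coordinate_def Let_def e)
qed

text \<open>Multiplication of the even coordinates \<open>o\<^sub>i\<^sup>-\<close> by \<open>t\<close>; the class is characterised by its
  coordinates, since those are a bijection from the moduli space to a torus.\<close>

definition rescale :: "nat \<Rightarrow> 'a::field \<Rightarrow> 'a twisted set \<Rightarrow> 'a twisted set" where
  "rescale n t C = (THE D. D \<in> moduli (2 * n) \<and>
     coordinate D = (\<lambda>k. (if even k then t else 1) * coordinate C k))"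

lemma
  assumes t: "t \<noteq> 0" and C: "C \<in> moduli (2 * n)"
  shows rescale_in_moduli: "rescale n t C \<in> moduli (2 * n)"
    and coordinate_rescale: "coordinate (rescale n t C) k = (if even k then t else 1) * coordinate C k"
proof -
  let ?c = "\<lambda>k. (if even k then t else 1) * coordinate C k"
  have "?c k \<noteq> 0" "?c (k + int (2 * n)) = ?c k" for k
    using t coordinate_nonzero[OF C, of k] coordinate_periodic[OF C, of k] by simp_all
  then obtain D where D: "D \<in> moduli (2 * n)" "coordinate D = ?c"
    by (rule moduli_exists)
  have "\<exists>!D. D \<in> moduli (2 * n) \<and> coordinate D = ?c"
  proof (rule ex1I[of _ D])
    fix E assume "E \<in> moduli (2 * n) \<and> coordinate E = ?c"
    then show "E = D" using D by (intro moduli_eqI[of E "2 * n" D]) simp_all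
  qed (use D in simp)
  then have "rescale n t C \<in> moduli (2 * n) \<and> coordinate (rescale n t C) = ?c"
    unfolding rescale_def by (rule theI')
  then show "rescale n t C \<in> moduli (2 * n)"
    "coordinate (rescale n t C) k = (if even k then t else 1) * coordinate C k" by simp_all
qed

section \<open>The leapfrog map in coordinates\<close>

text \<open>A lift of \<open>s\<^sub>i\<^sup>+\<close>, found by solving in the affine chart with \<open>s\<^sub>i = \<infinity>\<close>: there the involution is
  \<open>z \<mapsto> s\<^sub>i\<^sub>-\<^sub>1 + s\<^sub>i\<^sub>+\<^sub>1 - z\<close>, so \<open>s\<^sub>i\<^sup>+ = s\<^sub>i\<^sub>-\<^sub>1 + s\<^sub>i\<^sub>+\<^sub>1 - s\<^sub>i\<^sup>-\<close>.\<close>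

definition plus_lift :: "(int \<Rightarrow> 'a::field) \<Rightarrow> (int \<Rightarrow> 'a ^ 2) \<Rightarrow> int \<Rightarrow> 'a ^ 2" where
  "plus_lift c v i = c (2 * i) *s v (2 * i) - (c (2 * i) + 1 - c (2 * i + 1)) *s v (2 * i + 1)"

lemma recurrent_step:
  assumes "recurrent c v"
  shows "v (2 * i + 2) = v (2 * i + 1) - c (2 * i) *s v (2 * i)"
    and "v (2 * i + 3) = (1 - c (2 * i + 1)) *s v (2 * i + 1) - c (2 * i) *s v (2 * i)"
proof -
  show 2: "v (2 * i + 2) = v (2 * i + 1) - c (2 * i) *s v (2 * i)"
    using assms by (simp add: recurrent_def)
  have "v (2 * i + 1 + 2) = v (2 * i + 1 + 1) - c (2 * i + 1) *s v (2 * i + 1)"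
    using assms unfolding recurrent_def by blast
  then have "v (2 * i + 3) = v (2 * i + 2) - c (2 * i + 1) *s v (2 * i + 1)"
    by (simp add: add.assoc)
  then show "v (2 * i + 3) = (1 - c (2 * i + 1)) *s v (2 * i + 1) - c (2 * i) *s v (2 * i)"
    unfolding 2 by (simp add: vec_eq_iff algebra_simps)
qed

text \<open>With \<open>a, b\<close> the lifts of \<open>s\<^sub>i\<^sup>-, s\<^sub>i\<close>, the points \<open>s\<^sub>i\<^sub>-\<^sub>1\<close> and \<open>s\<^sub>i\<^sub>+\<^sub>1\<close> are spanned by \<open>a - b\<close> and
  \<open>(1 - y) b - x a\<close>. The matrix with \<open>b \<mapsto> - x b\<close> and \<open>a \<mapsto> w\<close> swaps these two lines, hence it
  represents the involution that defines the leapfrog map.\<close>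

lemma leapfrog_plus_lift:
  fixes v :: "int \<Rightarrow> 'a::field ^ 2"
  assumes c: "\<And>k. c k \<noteq> 0" and v: "recurrent c v" and v01: "bracket (v 0) (v 1) \<noteq> 0"
    and Sm: "\<And>j. Sm j = abs_proj_line (v (2 * j))" and S: "\<And>j. S j = abs_proj_line (v (2 * j + 1))"
    and distinct: "S (i - 1) \<noteq> S i" "S (i - 1) \<noteq> S (i + 1)" "S i \<noteq> S (i + 1)"
  shows "leapfrog_plus Sm S i = abs_proj_line (plus_lift c v i)"
proof -
  define a b where "a = v (2 * i)" and "b = v (2 * i + 1)"
  define x y where "x = c (2 * i)" and "y = c (2 * i + 1)"
  define w where "w = plus_lift c v i"
  define z where "z = v (2 * i - 1)"
  define d where "d = v (2 * i + 3)"
  note W = recurrent_bracket_nonzero[OF c v v01]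
  have nz: "v k \<noteq> 0" for k using W[of k] by auto
  have x: "x \<noteq> 0" by (simp add: x_def c)
  have w: "w = x *s a - (x + 1 - y) *s b"
    by (simp add: w_def plus_lift_def x_def y_def a_def b_def)
  have d: "d = (1 - y) *s b - x *s a"
    by (simp add: d_def recurrent_step[OF v] x_def y_def a_def b_def)
  have ab: "bracket a b \<noteq> 0" using W[of "2 * i"] by (simp add: a_def b_def)
  obtain r where r: "r \<noteq> 0" "z = r *s (a - b)"
  proof
    \<comment> \<open>The recurrence one step earlier, solved for the lift of \<open>s\<^sub>i\<^sub>-\<^sub>1\<close>.\<close>
    have "v (2 * i - 1 + 2) = v (2 * i - 1 + 1) - c (2 * i - 1) *s v (2 * i - 1)"
      using v unfolding recurrent_def by blast
    then have "b = a - c (2 * i - 1) *s z" by (simp add: a_def b_def z_def add.commute)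
    then show "z = inverse (c (2 * i - 1)) *s (a - b)"
      using c[of "2 * i - 1"] by (simp add: vector_smult_assoc)
    show "inverse (c (2 * i - 1)) \<noteq> 0" using c by simp
  qed
  have Sz: "S (i - 1) = abs_proj_line z" and Sd: "S (i + 1) = abs_proj_line d"
    and Sb: "S i = abs_proj_line b" and Sa: "Sm i = abs_proj_line a"
    by (simp_all add: S Sm z_def d_def a_def b_def algebra_simps)
  have nzs: "z \<noteq> 0" "d \<noteq> 0" "b \<noteq> 0" "a \<noteq> 0" by (simp_all add: z_def d_def a_def b_def nz)
  have "bracket w (- x *s b) \<noteq> 0" 
    by (simp only: w bracket_scale bracket_diff bracket_self) (use x ab in simp)
  from linear_map_exists[OF ab this]
  obtain T where T: "invertible T" "T *v a = w" "T *v b = - x *s b" .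
  have Tz: "T *v z = - r *s d"
    by (simp add: r(2) vector_scalar_commute matrix_vector_mult_diff_distrib T w d vec_eq_iff algebra_simps)
  have Td: "T *v d = - (x * x / r) *s z"
    using r(1)
    by (simp add: r(2) vector_scalar_commute matrix_vector_mult_diff_distrib T w d vec_eq_iff algebra_simps)
  have "(THE A. pgl_act A (S i) = S i \<and> pgl_act A (S (i - 1)) = S (i + 1) \<and>
      pgl_act A (S (i + 1)) = S (i - 1)) = abs_pgl2 T"
  proof (rule the_equality)
    show T': "pgl_act (abs_pgl2 T) (S i) = S i \<and> pgl_act (abs_pgl2 T) (S (i - 1)) = S (i + 1) \<and>
      pgl_act (abs_pgl2 T) (S (i + 1)) = S (i - 1)"
      unfolding Sz Sd Sb act_pt[OF T(1) nzs(1)] act_pt[OF T(1) nzs(2)] act_pt[OF T(1) nzs(3)] Tz Td T(3)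
      using nzs x r by (intro conjI pt_scale) auto
    fix A
    assume "pgl_act A (S i) = S i \<and> pgl_act A (S (i - 1)) = S (i + 1) \<and>
      pgl_act A (S (i + 1)) = S (i - 1)"
    with T' show "A = abs_pgl2 T"
      using distinct by (intro pgl_eqI[of "S (i - 1)" "S i" "S (i + 1)"]) simp_all
  qed
  then show ?thesis
    by (simp add: leapfrog_plus_def Sa act_pt T nzs w_def)
qed

text \<open>Every vector that occurs in two neighbouring cross-ratios of the image polygon is a combination of
  \<open>a\<close> and \<open>b\<close>, so every bracket is a multiple of \<open>[a, b]\<close>. Here \<open>a, b, v\<^sub>2, v\<^sub>3, v\<^sub>5\<close> are the lifts of \<open>s\<^sub>i\<^sup>-, s\<^sub>i, s\<^sub>i\<^sub>+\<^sub>1\<^sup>-, s\<^sub>i\<^sub>+\<^sub>1, s\<^sub>i\<^sub>+\<^sub>2\<close>, and \<open>w, w'\<close> those of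
  \<open>s\<^sub>i\<^sup>+, s\<^sub>i\<^sub>+\<^sub>1\<^sup>+\<close>.\<close>

lemma leapfrog_brackets:
  fixes a b :: "'a::field ^ 2"
  assumes W: "W = bracket a b" and w: "w = x *s a - (x + 1 - y) *s b"
    and v2: "v2 = b - x *s a" and v3: "v3 = (1 - y) *s b - x *s a"
    and w': "w' = x' *s v2 - (x' + 1 - y') *s v3" and v5: "v5 = (1 - y') *s v3 - x' *s v2"
  shows "bracket w b = x * W" "bracket v3 b = - (x * W)" "bracket v3 w' = - (x * W) * (x' * y)"
    "bracket w w' = x * W * (x' * y + x - x * y')"
    "bracket v3 w = (x * W) * x" "bracket v3 v5 = x * W * x' * y"
    "bracket w' v5 = - (x * W * x' * y * x')"
  using bracket_commute[of b a]
  by (simp_all add: W w v2 v3 w' v5 algebra_simps)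

lemma leapfrog_cross_ratios:
  fixes a b :: "'a::field ^ 2"
  assumes W: "W = bracket a b" and w: "w = x *s a - (x + 1 - y) *s b"
    and v2: "v2 = b - x *s a" and v3: "v3 = (1 - y) *s b - x *s a"
    and w': "w' = x' *s v2 - (x' + 1 - y') *s v3" and v5: "v5 = (1 - y') *s v3 - x' *s v2"
    and nz: "W \<noteq> 0" "x \<noteq> 0" "x' \<noteq> 0" "y \<noteq> 0"
  shows "bracket w b / bracket w w' * (bracket v3 w' / bracket v3 b) = x' * y / (x' * y + x - x * y')"
    "bracket v3 w / bracket v3 v5 * (bracket w' v5 / bracket w' w) = x * x' / (x' * y + x - x * y')"
proof -
  note br = leapfrog_brackets[OF W w v2 v3 w' v5]
  have "bracket w' w = - (x * W) * (x' * y + x - x * y')"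
    using br(4) bracket_commute[of w' w] by simp
  then show "bracket w b / bracket w w' * (bracket v3 w' / bracket v3 b) = x' * y / (x' * y + x - x * y')"
    "bracket v3 w / bracket v3 v5 * (bracket w' v5 / bracket w' w) = x * x' / (x' * y + x - x * y')"
    using nz by (simp_all add: br)
qed

text \<open>Evaluate the two cross-ratios on the lift of the source polygon. They belong to consecutive vertices
  of the image polygon, which is why \<open>o\<^sup>-\<close> is taken at \<open>i + 1\<close>: both then have the same denominator.\<close>

lemma
  fixes C D :: "'a::field twisted set"
  assumes "leapfrog n C D"
  shows leapfrog_source: "C \<in> moduli (2 * n)"
    and leapfrog_target: "D \<in> moduli (2 * n)"
    and leapfrog_o_plain: "o_plain D i = o_minus C (i + 1) * o_plain C i /
      (o_minus C (i + 1) * o_plain C i + o_minus C i - o_minus C i * o_plain C (i + 1))"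
    and leapfrog_o_minus: "o_minus D (i + 1) = o_minus C i * o_minus C (i + 1) /
      (o_minus C (i + 1) * o_plain C i + o_minus C i - o_minus C i * o_plain C (i + 1))"
proof -
  obtain Sm S M where pairs: "(Sm, S, M) \<in> leapfrog_pairs n"
    and q: "(intertwine S (leapfrog_plus Sm S), M) \<in> polygons (2 * n)"
    and C: "C = polygon_class (2 * n) (intertwine Sm S, M)"
    and D: "D = polygon_class (2 * n) (intertwine S (leapfrog_plus Sm S), M)"
    using assms unfolding leapfrog_def by blast
  define p where "p = intertwine Sm S"
  from pairs have p: "(p, M) \<in> polygons (2 * n)" and SM: "(S, M) \<in> polygons n"
    by (simp_all add: leapfrog_pairs_def p_def)
  show "C \<in> moduli (2 * n)" "D \<in> moduli (2 * n)"
    using p q unfolding C D p_def by (simp_all add: polygon_class_in_moduli)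
  define c where "c = consecutive_cross_ratio p"
  have c: "c k \<noteq> 0" for k
    unfolding c_def by (rule consecutive_cross_ratio_nonzero[OF polygonsD(1)[OF p]])
  obtain v where v: "recurrent c v" and v01: "bracket (v 0) (v 1) \<noteq> 0"
    and pv: "p = (\<lambda>k. abs_proj_line (v k))"
    unfolding c_def by (rule lift_exists[OF polygonsD(1)[OF p]])
  note W = recurrent_bracket_nonzero[OF c v v01]
  have nz: "v k \<noteq> 0" for k using W[of k] by auto
  have Sm: "Sm j = abs_proj_line (v (2 * j))" for j
    using fun_cong[OF pv, of "2 * j"] by (simp add: p_def intertwine_def)
  have S: "S j = abs_proj_line (v (2 * j + 1))" for j
    using fun_cong[OF pv, of "2 * j + 1"] by (simp add: p_def intertwine_def)
  have plus: "leapfrog_plus Sm S j = abs_proj_line (plus_lift c v j)" for j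
    by (rule leapfrog_plus_lift[OF c v v01 Sm S])
      (use genericD(1-3)[OF polygonsD(1)[OF SM], of "j - 1"] in \<open>simp_all add: add.commute\<close>)
  define u where "u = intertwine S (leapfrog_plus Sm S)"
  have u: "u (2 * j) = abs_proj_line (v (2 * j + 1))" "u (2 * j + 1) = abs_proj_line (plus_lift c v j)" for j
    by (simp_all add: u_def intertwine_def S plus)
  have u2: "u (2 * i + 2) = abs_proj_line (v (2 * i + 3))"
    "u (2 * i + 3) = abs_proj_line (plus_lift c v (i + 1))"
    "u (2 * i + 4) = abs_proj_line (v (2 * i + 5))"
    using u[of "i + 1"] u(1)[of "i + 2"] by (simp_all add: distrib_left add.assoc)
  have coord: "coordinate C = c" "coordinate D = consecutive_cross_ratio u"
    using coordinate_polygon_class[OF p] coordinate_polygon_class[OF q]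
    unfolding C D c_def u_def p_def by simp_all
  have plus_nz: "plus_lift c v j \<noteq> 0" for j
  proof -
    have "bracket (plus_lift c v j) (v (2 * j + 1)) \<noteq> 0"
      using W[of "2 * j"] c[of "2 * j"] by (simp add: plus_lift_def)
    then show ?thesis by auto
  qed
  define x y x' y' where "x = c (2 * i)" and "y = c (2 * i + 1)"
    and "x' = c (2 * i + 2)" and "y' = c (2 * i + 3)"
  have o: "o_minus C i = x" "o_minus C (i + 1) = x'" "o_plain C i = y" "o_plain C (i + 1) = y'"
    by (simp_all add: o_minus_eq o_plain_eq coord x_def y_def x'_def y'_def distrib_left add.assoc)
  have w: "plus_lift c v i = x *s v (2 * i) - (x + 1 - y) *s v (2 * i + 1)"
    by (simp add: plus_lift_def x_def y_def)
  have w': "plus_lift c v (i + 1) = x' *s v (2 * i + 2) - (x' + 1 - y') *s v (2 * i + 3)"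
    by (simp add: plus_lift_def x'_def y'_def distrib_left add.assoc)
  have v2: "v (2 * i + 2) = v (2 * i + 1) - x *s v (2 * i)"
    and v3: "v (2 * i + 3) = (1 - y) *s v (2 * i + 1) - x *s v (2 * i)"
    unfolding x_def y_def by (rule recurrent_step[OF v])+
  have v5: "v (2 * i + 5) = (1 - y') *s v (2 * i + 3) - x' *s v (2 * i + 2)"
    using recurrent_step(2)[OF v, of "i + 1"] by (simp add: x'_def y'_def distrib_left add.assoc)
  have xy: "x \<noteq> 0" "x' \<noteq> 0" "y \<noteq> 0" by (simp_all add: x_def x'_def y_def c)
  note cr = leapfrog_cross_ratios[OF refl w v2 v3 w' v5 W xy]
  have "o_plain D i = cross_ratio (u (2 * i + 1)) (u (2 * i + 2)) (u (2 * i)) (u (2 * i + 3))"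
    by (simp add: o_plain_eq coord consecutive_cross_ratio_def add.assoc)
  also have "\<dots> = x' * y / (x' * y + x - x * y')"
    unfolding u u2 by (simp only: cross_ratio_pt[OF plus_nz nz nz plus_nz] cr)
  finally show "o_plain D i = o_minus C (i + 1) * o_plain C i /
      (o_minus C (i + 1) * o_plain C i + o_minus C i - o_minus C i * o_plain C (i + 1))"
    by (simp only: o)
  have "o_minus D (i + 1) = cross_ratio (u (2 * i + 2)) (u (2 * i + 3)) (u (2 * i + 1)) (u (2 * i + 4))"
    by (simp add: o_minus_eq coord consecutive_cross_ratio_def distrib_left add.assoc add.commute[of 1])
  also have "\<dots> = x * x' / (x' * y + x - x * y')"
    unfolding u u2 by (simp only: cross_ratio_pt[OF nz plus_nz plus_nz nz] cr)
  finally show "o_minus D (i + 1) = o_minus C i * o_minus C (i + 1) /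
      (o_minus C (i + 1) * o_plain C i + o_minus C i - o_minus C i * o_plain C (i + 1))"
    by (simp only: o)
qed

section \<open>Rescaling commutes with the leapfrog map\<close>

lemma o_minus_rescale:
  "t \<noteq> 0 \<Longrightarrow> C \<in> moduli (2 * n) \<Longrightarrow> o_minus (rescale n t C) i = t * o_minus C i"
  by (simp add: o_minus_eq coordinate_rescale)

lemma o_plain_rescale:
  "t \<noteq> 0 \<Longrightarrow> C \<in> moduli (2 * n) \<Longrightarrow> o_plain (rescale n t C) i = o_plain C i"
  by (simp add: o_plain_eq coordinate_rescale)

lemma moduli_eqI_o:
  assumes "C \<in> moduli m" "D \<in> moduli m" "\<And>i. o_minus C i = o_minus D i" "\<And>i. o_plain C i = o_plain D i"
  shows "C = D"
proof (rule moduli_eqI[OF assms(1,2)], rule ext)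
  fix k :: int
  show "coordinate C k = coordinate D k"
  proof (cases "even k")
    case True
    then show ?thesis using assms(3) by (auto simp: o_minus_eq elim!: evenE)
  next
    case False
    then show ?thesis using assms(4) by (auto simp: o_plain_eq elim!: oddE)
  qed
qed

text \<open>Rescaling multiplies the common denominator of the coordinate formulas by \<open>t\<close>, the numerator for
  \<open>o\<^sub>i\<close> by \<open>t\<close> and the one for \<open>o\<^sub>i\<^sub>+\<^sub>1\<^sup>-\<close> by \<open>t\<^sup>2\<close>. Coordinates determine the class.\<close>

lemma leapfrog_rescale:
  assumes t: "t \<noteq> 0" and CD: "leapfrog n C D" and CE: "leapfrog n (rescale n t C) E"
  shows "E = rescale n t D"
proof -
  note C = leapfrog_source[OF CD] and D = leapfrog_target[OF CD] and E = leapfrog_target[OF CE]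
  note o = o_minus_rescale[OF t C] o_plain_rescale[OF t C]
  define den where "den i = o_minus C (i + 1) * o_plain C i + o_minus C i - o_minus C i * o_plain C (i + 1)" for i
  have den: "t * o_minus C (i + 1) * o_plain C i + t * o_minus C i - t * o_minus C i * o_plain C (i + 1) = t * den i" for i
    by (simp add: den_def algebra_simps)
  have plain: "o_plain E i = o_plain D i" for i
    using t unfolding leapfrog_o_plain[OF CE] leapfrog_o_plain[OF CD] o den den_def[symmetric]
    by (simp add: mult.assoc)
  have "o_minus E (i + 1) = t * o_minus D (i + 1)" for i
    using t unfolding leapfrog_o_minus[OF CE] leapfrog_o_minus[OF CD] o den den_def[symmetric]
    by (simp add: mult.assoc)
  from this[of "i - 1" for i] have minus: "o_minus E i = t * o_minus D i" for i by simp
  show ?thesis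
    by (rule moduli_eqI_o[OF E rescale_in_moduli[OF t D]])
      (simp_all add: o_minus_rescale[OF t D] o_plain_rescale[OF t D] plain minus)
qed

section \<open>Rescaling as an action of the algebraic group\<close>

text \<open>The exponent of \<open>t\<close> by which a monomial scales: coordinate \<open>2 i\<close> is \<open>o\<^sub>i\<^sup>-\<close>.\<close>

definition even_degree :: "(nat \<Rightarrow>\<^sub>0 int) \<Rightarrow> int" where
  "even_degree e = (\<Sum>k\<in>Poly_Mapping.keys e. if even k then Poly_Mapping.lookup e k else 0)"

lemma even_degree_superset:
  assumes "finite S" "Poly_Mapping.keys e \<subseteq> S"
  shows "even_degree e = (\<Sum>k\<in>S. if even k then Poly_Mapping.lookup e k else 0)"
  unfolding even_degree_def using assms
  by (intro sum.mono_neutral_left) (auto simp: in_keys_iff)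

lemma even_degree_add: "even_degree (d + e) = even_degree d + even_degree e"
proof -
  let ?S = "Poly_Mapping.keys d \<union> Poly_Mapping.keys e"
  have "even_degree (d + e) = (\<Sum>k\<in>?S. if even k then Poly_Mapping.lookup (d + e) k else 0)"
    by (rule even_degree_superset) (simp_all add: keys_add)
  also have "\<dots> = (\<Sum>k\<in>?S. if even k then Poly_Mapping.lookup d k else 0)
      + (\<Sum>k\<in>?S. if even k then Poly_Mapping.lookup e k else 0)"
    unfolding sum.distrib[symmetric] by (rule sum.cong) (simp_all add: lookup_add)
  also have "\<dots> = even_degree d + even_degree e"
    by (simp add: even_degree_superset[of ?S])
  finally show ?thesis .
qed

lemma even_degree_zero [simp]: "even_degree 0 = 0"
  by (simp add: even_degree_def)

lemma even_degree_single [simp]: "even_degree (Poly_Mapping.single k a) = (if even k then a else 0)"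
  by (simp add: even_degree_superset[of "{k}"])

text \<open>The coaction \<open>f \<mapsto> \<Sum>\<^sub>d t\<^sup>d f\<^sub>d\<close>, where \<open>f\<^sub>d\<close> is the part of \<open>f\<close> of even degree \<open>d\<close>.\<close>

definition grading :: "'a::field laurent \<Rightarrow> int \<Rightarrow>\<^sub>0 'a laurent" where
  "grading f = (\<Sum>e\<in>Poly_Mapping.keys f.
     Poly_Mapping.single (even_degree e) (Poly_Mapping.single e (Poly_Mapping.lookup f e)))"

lemma lookup_grading:
  "Poly_Mapping.lookup (Poly_Mapping.lookup (grading f) k) e =
    (if even_degree e = k then Poly_Mapping.lookup f e else 0)"
proof -
  have "Poly_Mapping.lookup (Poly_Mapping.lookup (grading f) k) e =
      (\<Sum>d\<in>Poly_Mapping.keys f. if d = e then (if even_degree e = k then Poly_Mapping.lookup f e else 0) else 0)"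
    unfolding grading_def lookup_sum by (rule sum.cong) (auto simp: lookup_single when_def)
  then show ?thesis by (auto simp: in_keys_iff)
qed

lemma grading_eqI:
  fixes F G :: "int \<Rightarrow>\<^sub>0 'a::field laurent"
  assumes "\<And>k e. Poly_Mapping.lookup (Poly_Mapping.lookup F k) e = Poly_Mapping.lookup (Poly_Mapping.lookup G k) e"
  shows "F = G"
  by (intro poly_mapping_eqI assms)

lemma grading_add: "grading (f + g) = grading f + grading g"
  by (rule grading_eqI) (simp add: lookup_grading lookup_add)

lemma grading_zero: "grading 0 = 0"
  by (simp add: grading_def)

lemma grading_single: "grading (Poly_Mapping.single e a) = Poly_Mapping.single (even_degree e) (Poly_Mapping.single e a)"
  by (rule grading_eqI) (simp add: lookup_grading lookup_single when_def)

lemma grading_sum: "grading (sum f S) = (\<Sum>x\<in>S. grading (f x))"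
  by (induct S rule: infinite_finite_induct) (simp_all add: grading_zero grading_add)

lemma sum_monomials: "(\<Sum>e\<in>Poly_Mapping.keys f. Poly_Mapping.single e (Poly_Mapping.lookup f e)) = f"
proof (rule poly_mapping_eqI)
  fix d
  have "Poly_Mapping.lookup (\<Sum>e\<in>Poly_Mapping.keys f. Poly_Mapping.single e (Poly_Mapping.lookup f e)) d
      = (\<Sum>e\<in>Poly_Mapping.keys f. if e = d then Poly_Mapping.lookup f d else 0)"
    unfolding lookup_sum by (rule sum.cong) (auto simp: lookup_single when_def)
  then show "Poly_Mapping.lookup (\<Sum>e\<in>Poly_Mapping.keys f. Poly_Mapping.single e (Poly_Mapping.lookup f e)) d
      = Poly_Mapping.lookup f d"
    by (auto simp: in_keys_iff)
qed

text \<open>By bilinearity it suffices to compare monomials, where it is additivity of the degree.\<close>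

lemma grading_mult: "grading (f * g) = grading f * grading g"
proof -
  let ?m = "\<lambda>f e. Poly_Mapping.single e (Poly_Mapping.lookup f e)"
  have "f * g = (\<Sum>d\<in>Poly_Mapping.keys f. ?m f d) * (\<Sum>e\<in>Poly_Mapping.keys g. ?m g e)"
    by (simp only: sum_monomials)
  also have "\<dots> = (\<Sum>d\<in>Poly_Mapping.keys f. \<Sum>e\<in>Poly_Mapping.keys g. ?m f d * ?m g e)"
    by (rule sum_product)
  finally have "grading (f * g) = (\<Sum>d\<in>Poly_Mapping.keys f. \<Sum>e\<in>Poly_Mapping.keys g. grading (?m f d * ?m g e))"
    by (simp only: grading_sum)
  also have "\<dots> = (\<Sum>d\<in>Poly_Mapping.keys f. \<Sum>e\<in>Poly_Mapping.keys g.
      Poly_Mapping.single (even_degree d) (?m f d) * Poly_Mapping.single (even_degree e) (?m g e))"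
    by (simp only: mult_single grading_single even_degree_add)
  also have "\<dots> = grading f * grading g"
    unfolding grading_def by (rule sum_product[symmetric])
  finally show ?thesis .
qed

lemma keys_homogeneous_part:
  "Poly_Mapping.keys (Poly_Mapping.lookup (grading f) k) = {e \<in> Poly_Mapping.keys f. even_degree e = k}"
  by (auto simp: in_keys_iff lookup_grading split: if_splits)

lemma keys_grading: "Poly_Mapping.keys (grading f) = even_degree ` Poly_Mapping.keys f"
proof -
  have "k \<in> Poly_Mapping.keys (grading f) \<longleftrightarrow> Poly_Mapping.keys (Poly_Mapping.lookup (grading f) k) \<noteq> {}" for k
    by (simp add: in_keys_iff)
  then show ?thesis by (auto simp: keys_homogeneous_part)
qed

lemma sum_homogeneous_parts:
  "(\<Sum>k\<in>Poly_Mapping.keys (grading f). Poly_Mapping.lookup (grading f) k) = f"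
proof (rule poly_mapping_eqI)
  fix e
  show "Poly_Mapping.lookup (\<Sum>k\<in>Poly_Mapping.keys (grading f). Poly_Mapping.lookup (grading f) k) e
      = Poly_Mapping.lookup f e"
    by (auto simp: lookup_sum lookup_grading keys_grading in_keys_iff)
qed

lemma Gm_coaction_grading: "Gm_coaction m grading"
  unfolding Gm_coaction_def
proof (intro conjI ballI allI)
  show "Poly_Mapping.lookup (grading f) k \<in> regular_functions m" if "f \<in> regular_functions m" for f :: "'a laurent" and k
    using that by (auto simp: regular_functions_def keys_homogeneous_part)
  show "Poly_Mapping.lookup (grading (Poly_Mapping.lookup (grading f) k)) l =
      (if k = l then Poly_Mapping.lookup (grading f) k else 0)" for f :: "'a laurent" and k l
    by (rule poly_mapping_eqI) (simp add: lookup_grading)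
qed (simp_all add: grading_single grading_add grading_mult sum_homogeneous_parts)

definition monomial_value :: "'a::field twisted set \<Rightarrow> (nat \<Rightarrow>\<^sub>0 int) \<Rightarrow> 'a" where
  "monomial_value C e = (\<Prod>k\<in>Poly_Mapping.keys e. coordinate C (int k) powi Poly_Mapping.lookup e k)"

lemma regular_value_eq: "regular_value f C = (\<Sum>e\<in>Poly_Mapping.keys f. Poly_Mapping.lookup f e * monomial_value C e)"
  by (simp add: regular_value_def monomial_value_def)

lemma power_int_sum:
  fixes t :: "'a::field"
  assumes "t \<noteq> 0"
  shows "t powi (\<Sum>x\<in>S. f x) = (\<Prod>x\<in>S. t powi f x)"
  using assms by (induct S rule: infinite_finite_induct) (simp_all add: power_int_add)

lemma monomial_value_rescale:
  assumes t: "t \<noteq> 0" and C: "C \<in> moduli (2 * n)"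
  shows "monomial_value (rescale n t C) e = t powi even_degree e * monomial_value C e"
  unfolding monomial_value_def even_degree_def power_int_sum[OF t] prod.distrib[symmetric]
  by (rule prod.cong) (simp_all add: coordinate_rescale[OF t C] power_int_mult_distrib)

text \<open>A monomial of even degree \<open>k\<close> scales by \<open>t\<^sup>k\<close>; collect the monomials by degree.\<close>

lemma regular_value_rescale:
  assumes t: "t \<noteq> 0" and C: "C \<in> moduli (2 * n)"
  shows "regular_value f (rescale n t C) =
    (\<Sum>k\<in>Poly_Mapping.keys (grading f). t powi k * regular_value (Poly_Mapping.lookup (grading f) k) C)"
proof -
  have part: "t powi k * regular_value (Poly_Mapping.lookup (grading f) k) C =
      (\<Sum>e\<in>{e \<in> Poly_Mapping.keys f. even_degree e = k}.
        Poly_Mapping.lookup f e * (t powi even_degree e * monomial_value C e))" for k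
    unfolding regular_value_eq keys_homogeneous_part sum_distrib_left
    by (rule sum.cong) (auto simp: lookup_grading)
  show ?thesis
    unfolding part keys_grading
    unfolding regular_value_eq monomial_value_rescale[OF t C]
    by (rule sum.image_gen) simp
qed

lemma algebraic_Gm_action_rescale:
  "algebraic_Gm_action (2 * n) (rescale n :: 'a::field \<Rightarrow> _) grading"
  unfolding algebraic_Gm_action_def
proof (intro conjI allI impI ballI)
  fix t s :: 'a and C :: "'a twisted set"
  assume t: "t \<noteq> 0" and s: "s \<noteq> 0" and C: "C \<in> moduli (2 * n)"
  note sC = rescale_in_moduli[OF s C]
  have ts: "t * s \<noteq> 0" using t s by simp
  show "rescale n (t * s) C = rescale n t (rescale n s C)"
    by (rule moduli_eqI[OF rescale_in_moduli[OF ts C] rescale_in_moduli[OF t sC]])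
      (auto simp: coordinate_rescale[OF ts C] coordinate_rescale[OF t sC] coordinate_rescale[OF s C])
next
  fix C :: "'a twisted set" assume C: "C \<in> moduli (2 * n)"
  show "rescale n 1 C = C"
    by (rule moduli_eqI[OF rescale_in_moduli[OF one_neq_zero C] C])
      (auto simp: coordinate_rescale[OF one_neq_zero C])
qed (simp_all add: rescale_in_moduli Gm_coaction_grading regular_value_rescale)

lemma grading_coordinate_function:
  "grading (coordinate_function k :: 'a::field laurent) =
    Poly_Mapping.single (if even k then 1 else 0) (coordinate_function k)"
  by (simp add: coordinate_function_def grading_single)

text \<open>Non-triviality is seen on \<open>o\<^sub>0\<^sup>-\<close>, which has degree 1; it exists because \<open>n \<ge> 1\<close>.\<close>

lemma scaling_symmetry_rescale:
  assumes "n \<ge> 1"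
  shows "scaling_symmetry n (rescale n :: 'a::field \<Rightarrow> _) grading"
  unfolding scaling_symmetry_def
proof (intro conjI)
  show "algebraic_Gm_action (2 * n) (rescale n :: 'a \<Rightarrow> _) grading"
    by (rule algebraic_Gm_action_rescale)
  let ?X = "coordinate_function 0 :: 'a laurent"
  show "\<exists>f\<in>regular_functions (2 * n). grading f \<noteq> Poly_Mapping.single 0 (f :: 'a laurent)"
  proof
    show "?X \<in> regular_functions (2 * n)"
      using assms by (simp add: coordinate_function_def regular_functions_def)
    have "?X \<noteq> 0"
      unfolding coordinate_function_def by (metis lookup_single_eq lookup_zero one_neq_zero)
    then have "Poly_Mapping.lookup (grading ?X) 1 \<noteq> Poly_Mapping.lookup (Poly_Mapping.single 0 ?X) (1 :: int)"
      by (simp add: grading_coordinate_function lookup_single when_def)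
    then show "grading ?X \<noteq> Poly_Mapping.single 0 ?X" by metis
  qed
  show "\<forall>t C D E. (t :: 'a) \<noteq> 0 \<longrightarrow> leapfrog n C D \<longrightarrow> leapfrog n (rescale n t C) E \<longrightarrow> E = rescale n t D"
    using leapfrog_rescale by blast
qed

theorem proposition5p1:
  fixes n :: nat
  assumes "n \<ge> 1"
  shows "\<exists>(act :: 'a::field \<Rightarrow> 'a twisted set \<Rightarrow> 'a twisted set) \<rho>.
    scaling_symmetry n act \<rho> \<and>
    (\<forall>t C. t \<noteq> 0 \<longrightarrow> C \<in> moduli (2 * n) \<longrightarrow>
       act t C \<in> moduli (2 * n) \<and>
       (\<forall>i. o_minus (act t C) i = t * o_minus C i \<and> o_plain (act t C) i = o_plain C i)) \<and>
    (\<forall>i<n. \<rho> (coordinate_function (2 * i)) =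
             Poly_Mapping.single 1 (coordinate_function (2 * i)) \<and>
           \<rho> (coordinate_function (2 * i + 1)) =
             Poly_Mapping.single 0 (coordinate_function (2 * i + 1)))"
  by (intro exI[of _ "rescale n"] exI[of _ grading])
    (simp add: scaling_symmetry_rescale[OF assms] rescale_in_moduli o_minus_rescale o_plain_rescale
      grading_coordinate_function)

end
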